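(* For a Cartesian closed left additive category $\mathbb{X}$, there is a bijective correspondence between: (i) differential combinators $\mathsf{D}$ on $\mathbb{X}$ which satisfy [CD.$\lambda$] (or equivalently [CD.ev]); (ii) closed systems of linearizing combinators $\mathsf{L}^C$ on $\mathbb{X}$; (iii) exponentiable linearizing combinators $\mathsf{L}$ on $\mathbb{X}$. Therefore, a Cartesian closed differential category is precisely a Cartesian closed left additive category equipped with an exponentiable linearizing combinator, or equivalently a Cartesian closed left additive category equipped with a closed system of linearizing combinators.
   Context: Composition is in diagrammatic order: $fg$ means first $f$, then $g$; identities are written $1$. A left additive category is a category whose hom-sets are commutative monoids $(+,0)$ with $f(g+h)=fg+fh$ and $f0=0$. A map $f$ is additive if $0f=0$ and $(g+h)f=gf+hf$ for all $g,h$. A Cartesian left additive category is a left additive category with (chosen) finite products whose projections $\pi_0,\pi_1$ are additive; $\langle -,-\rangle$ is pairing, $f\times g=\langle \pi_0 f,\pi_1 g\rangle$, $\top$ is the terminal object. Put $\oplus_A:=\pi_0+\pi_1:A\times A\to A$; $\tau:=\langle\pi_1,\pi_0\rangle:A\times B\to B\times A$; $\ell_{A,B,C,D}:=\langle 1,0\rangle\times\langle 0,1\rangle: A\times D\to (A\times B)\times(C\times D)$; $c_{A,B,C,D}:=\langle \pi_0\times\pi_0,\pi_1\times\pi_1\rangle:(A\times B)\times(C\times D)\to(A\times C)\times(B\times D)$ (subscripts omitted). In a Cartesian closed category: $[C,A]$ is the internal hom, $\epsilon:C\times[C,A]\to A$ evaluation, $\lambda(f):A\to[C,B]$ the curry of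 $f:C\times A\to B$ (the unique map with $(1\times\lambda(f))\epsilon=f$), and $\lambda^{-1}(g)=(1\times g)\epsilon$ for $g:A\to[C,B]$. For $f:C\to D$, $g:A\to B$ put $[f,g]:=\lambda((f\times 1)\epsilon g):[D,A]\to[C,B]$. Put $\eta:=\lambda(\pi_1):A\to[C,A]$ and $\mu:=\lambda(\langle\pi_0,\epsilon\rangle\epsilon):[C,[C,A]]\to[C,A]$. A Cartesian closed left additive category is a Cartesian left additive category that is Cartesian closed with $\lambda(f+g)=\lambda(f)+\lambda(g)$ and $\lambda(0)=0$. A differential combinator $\mathsf{D}$ on a Cartesian left additive category $\mathbb{X}$ is a family of operators $\mathsf{D}:\mathbb{X}(A,B)\to\mathbb{X}(A\times A,B)$ such that: [CD.1] $\mathsf{D}[f+g]=\mathsf{D}[f]+\mathsf{D}[g]$, $\mathsf{D}[0]=0$; [CD.2] $(1\times\oplus_A)\mathsf{D}[f]=(1\times\pi_0)\mathsf{D}[f]+(1\times\pi_1)\mathsf{D}[f]$, $\langle 1,0\rangle\mathsf{D}[f]=0$; [CD.3] $\mathsf{D}[1]=\pi_1$, $\mathsf{D}[\pi_0]=\pi_1\pi_0$, $\mathsf{D}[\pi_1]=\pi_1\pi_1$; [CD.4] $\mathsf{D}[\langle f,g\rangle]=\langle\mathsf{D}[f],\mathsf{D}[g]\rangle$; [CD.5] $\mathsf{D}[fg]=\langle\pi_0 f,\mathsf{D}[f]\rangle\mathsf{D}[g]$; [CD.6] $\ell\,\mathsf{D}[\mathsf{D}[f]]=\mathsf{D}[f]$;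 [CD.7] $c\,\mathsf{D}[\mathsf{D}[f]]=\mathsf{D}[\mathsf{D}[f]]$. For $f:C\times A\to B$ put $\mathsf{D}^C[f]:=\langle 1\times\pi_0,0\times\pi_1\rangle\mathsf{D}[f]: C\times(A\times A)\to B$. A Cartesian closed differential category is a Cartesian closed left additive category with a differential combinator satisfying [CD.$\lambda$]: $\mathsf{D}[\lambda(f)]=\lambda(\mathsf{D}^C[f])$ for every $f:C\times A\to B$; equivalently (known) [CD.ev]: $\mathsf{D}^C[\epsilon]=(1\times\pi_1)\epsilon$ for every evaluation map $\epsilon:C\times[C,A]\to A$. A linearizing combinator $\mathsf{L}$ on a Cartesian left additive category $\mathbb{X}$ is a family of operators $\mathsf{L}:\mathbb{X}(A,B)\to\mathbb{X}(A,B)$ such that: [L.1] $\mathsf{L}[f+g]=\mathsf{L}[f]+\mathsf{L}[g]$, $\mathsf{L}[0]=0$; [L.2] $\mathsf{L}[f]$ is additive; [L.3] $\mathsf{L}[1]=1$, $\mathsf{L}[\pi_0]=\pi_0$, $\mathsf{L}[\pi_1]=\pi_1$; [L.4] $\mathsf{L}[\langle f,g\rangle]=\langle\mathsf{L}[f],\mathsf{L}[g]\rangle$; [L.5] $\mathsf{L}[fg]=\mathsf{L}[f]\,\mathsf{L}[(1+0f)g]$; [L.6] $\mathsf{L}[\mathsf{L}[f]]=\mathsf{L}[f]$. It is exponentiable (on a Cartesian closed left additive category) if moreover: [EL.1] $\mathsf{L}[\eta]=\eta$, $\mathsf{L}[\mu]=\mu$; [EL.2] $\mathsf{L}[\,[f,g]\,]=[f,\mathsf{L}[g]]$;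 [EL.3] for every $f:A\times B\to C$, $\mathsf{L}_0[\mathsf{L}_1[f]]=\mathsf{L}_1[\mathsf{L}_0[f]]$, where $\mathsf{L}_0[f]:=\tau\lambda^{-1}(\mathsf{L}[\lambda(\tau f)])$ and $\mathsf{L}_1[f]:=\lambda^{-1}(\mathsf{L}[\lambda(f)])$. A system of linearizing combinators on $\mathbb{X}$ is a family, indexed by objects $C$, of operators $\mathsf{L}^C:\mathbb{X}(C\times A,B)\to\mathbb{X}(C\times A,B)$ such that: [L.1] $\mathsf{L}^{C}[f+g]=\mathsf{L}^{C}[f]+\mathsf{L}^{C}[g]$, $\mathsf{L}^{C}[0]=0$; [L.2] $(1\times\oplus_A)\mathsf{L}^{C}[f]=(1\times\pi_0)\mathsf{L}^{C}[f]+(1\times\pi_1)\mathsf{L}^{C}[f]$, $\langle\pi_0,0\rangle\mathsf{L}^{C}[f]=0$; [L.3] $\mathsf{L}^{C}[\pi_1]=\pi_1$, $\mathsf{L}^{C}[\pi_1\pi_0]=\pi_1\pi_0$, $\mathsf{L}^{C}[\pi_1\pi_1]=\pi_1\pi_1$; [L.4] $\mathsf{L}^{C}[\langle f,g\rangle]=\langle\mathsf{L}^{C}[f],\mathsf{L}^{C}[g]\rangle$; [L.5] for $f:C\times A\to B$, $g:C\times B\to D$, $\mathsf{L}^{C}[\langle\pi_0,f\rangle g]=\langle\pi_0,\mathsf{L}^{C}[f]\rangle\,\mathsf{L}^{C}[\langle\pi_0,\pi_1+\langle\pi_0,0\rangle f\rangle g]$; [L.6] $\mathsf{L}^{C}[\mathsf{L}^{C}[f]]=\mathsf{L}^{C}[f]$;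 [L.7] with the isomorphisms $\alpha=\langle 1\times\pi_0,\pi_1\pi_1\rangle:C\times(A\times B)\to(C\times A)\times B$ and $\beta=\langle 1\times\pi_1,\pi_1\pi_0\rangle:C\times(A\times B)\to(C\times B)\times A$, and for $f:C\times(A\times B)\to D$, $\mathsf{L}^C_0[f]:=\beta\,\mathsf{L}^{C\times B}[\beta^{-1}f]$, $\mathsf{L}^C_1[f]:=\alpha\,\mathsf{L}^{C\times A}[\alpha^{-1}f]$, one has $\mathsf{L}^C_1[\mathsf{L}^C_0[f]]=\mathsf{L}^C_0[\mathsf{L}^C_1[f]]$; [L.8] for every $h:C'\to C$ and $f:C\times A\to B$, $(h\times 1)\mathsf{L}^{C}[f]=\mathsf{L}^{C'}[(h\times 1)f]$. A system of linearizing combinators on a Cartesian closed left additive category is closed if moreover [L.$\lambda$]: for every $f:C\times A\to B$, $\mathsf{L}[\lambda(f)]=\lambda(\mathsf{L}^C[f])$, where for $g:A\to B$ one puts $\mathsf{L}[g]:=\langle 0,1\rangle\mathsf{L}^\top[\pi_1 g]$ (with $\langle 0,1\rangle:A\to\top\times A$). *)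

theory Defs
  imports Main
begin

section \<open>Cartesian closed left additive categories\<close>

text \<open>
  A category is a set of objects together with a single set of arrows carrying their source and
  target. Composition is in diagrammatic order: \<open>f \<cdot> g\<close> is first \<open>f\<close>, then \<open>g\<close>.
  All chosen structure (products, internal homs) belongs to the record.
\<close>

record ('o, 'm) category =
  obj :: "'o set"
  arr :: "'m set"
  src :: "'m \<Rightarrow> 'o"
  tgt :: "'m \<Rightarrow> 'o"
  ident :: "'o \<Rightarrow> 'm" ("\<one>\<index>")
  compose :: "'m \<Rightarrow> 'm \<Rightarrow> 'm" (infixl "\<cdot>\<index>" 70)

definition hom :: "('o, 'm, 'z) category_scheme \<Rightarrow> 'o \<Rightarrow> 'o \<Rightarrow> 'm set" where
  "hom X A B = {f \<in> arr X. src X f = A \<and> tgt X f = B}"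

locale category =
  fixes X :: "('o, 'm, 'z) category_scheme" (structure)
  assumes src_obj: "f \<in> arr X \<Longrightarrow> src X f \<in> obj X"
    and tgt_obj: "f \<in> arr X \<Longrightarrow> tgt X f \<in> obj X"
    and ident_hom: "A \<in> obj X \<Longrightarrow> \<one> A \<in> hom X A A"
    and compose_hom: "\<lbrakk>f \<in> hom X A B; g \<in> hom X B C\<rbrakk> \<Longrightarrow> f \<cdot> g \<in> hom X A C"
    and ident_left: "f \<in> hom X A B \<Longrightarrow> \<one> A \<cdot> f = f"
    and ident_right: "f \<in> hom X A B \<Longrightarrow> f \<cdot> \<one> B = f"
    and compose_assoc:
      "\<lbrakk>f \<in> hom X A B; g \<in> hom X B C; h \<in> hom X C D\<rbrakk> \<Longrightarrow> (f \<cdot> g) \<cdot> h = f \<cdot> (g \<cdot> h)"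

record ('o, 'm) left_additive_category = "('o, 'm) category" +
  add :: "'m \<Rightarrow> 'm \<Rightarrow> 'm" (infixl "\<oplus>\<index>" 65)
  zero :: "'o \<Rightarrow> 'o \<Rightarrow> 'm" ("\<zero>\<index>")

locale left_additive_category = category X
  for X :: "('o, 'm, 'z) left_additive_category_scheme" (structure) +
  assumes zero_hom: "\<lbrakk>A \<in> obj X; B \<in> obj X\<rbrakk> \<Longrightarrow> \<zero> A B \<in> hom X A B"
    and add_hom: "\<lbrakk>f \<in> hom X A B; g \<in> hom X A B\<rbrakk> \<Longrightarrow> f \<oplus> g \<in> hom X A B"
    and add_assoc:
      "\<lbrakk>f \<in> hom X A B; g \<in> hom X A B; h \<in> hom X A B\<rbrakk> \<Longrightarrow> (f \<oplus> g) \<oplus> h = f \<oplus> (g \<oplus> h)"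
    and add_commute: "\<lbrakk>f \<in> hom X A B; g \<in> hom X A B\<rbrakk> \<Longrightarrow> f \<oplus> g = g \<oplus> f"
    and zero_add: "f \<in> hom X A B \<Longrightarrow> \<zero> A B \<oplus> f = f"
    and compose_add:
      "\<lbrakk>f \<in> hom X A B; g \<in> hom X B C; h \<in> hom X B C\<rbrakk> \<Longrightarrow> f \<cdot> (g \<oplus> h) = f \<cdot> g \<oplus> f \<cdot> h"
    and compose_zero: "\<lbrakk>f \<in> hom X A B; C \<in> obj X\<rbrakk> \<Longrightarrow> f \<cdot> \<zero> B C = \<zero> A C"

definition additive :: "('o, 'm, 'z) left_additive_category_scheme \<Rightarrow> 'm \<Rightarrow> bool" where
  "additive X f \<longleftrightarrow> f \<in> arr X \<and>
     (\<forall>A\<in>obj X. \<zero>\<^bsub>X\<^esub> A (src X f) \<cdot>\<^bsub>X\<^esub> f = \<zero>\<^bsub>X\<^esub> A (tgt X f)) \<and>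
     (\<forall>A\<in>obj X. \<forall>g\<in>hom X A (src X f). \<forall>h\<in>hom X A (src X f).
        (g \<oplus>\<^bsub>X\<^esub> h) \<cdot>\<^bsub>X\<^esub> f = g \<cdot>\<^bsub>X\<^esub> f \<oplus>\<^bsub>X\<^esub> h \<cdot>\<^bsub>X\<^esub> f)"

record ('o, 'm) cartesian_left_additive_category = "('o, 'm) left_additive_category" +
  prod :: "'o \<Rightarrow> 'o \<Rightarrow> 'o" (infixl "\<otimes>\<index>" 72)
  proj0 :: "'o \<Rightarrow> 'o \<Rightarrow> 'm" ("\<pi>\<^sub>0\<index>")
  proj1 :: "'o \<Rightarrow> 'o \<Rightarrow> 'm" ("\<pi>\<^sub>1\<index>")
  pairing :: "'m \<Rightarrow> 'm \<Rightarrow> 'm" ("\<langle>_, _\<rangle>\<index>")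
  terminal :: "'o" ("\<top>\<index>")

locale cartesian_left_additive_category = left_additive_category X
  for X :: "('o, 'm, 'z) cartesian_left_additive_category_scheme" (structure) +
  assumes terminal_obj: "\<top> \<in> obj X"
    and terminal_unique: "A \<in> obj X \<Longrightarrow> \<exists>!f. f \<in> hom X A \<top>"
    and prod_obj: "\<lbrakk>A \<in> obj X; B \<in> obj X\<rbrakk> \<Longrightarrow> A \<otimes> B \<in> obj X"
    and proj0_hom: "\<lbrakk>A \<in> obj X; B \<in> obj X\<rbrakk> \<Longrightarrow> \<pi>\<^sub>0 A B \<in> hom X (A \<otimes> B) A"
    and proj1_hom: "\<lbrakk>A \<in> obj X; B \<in> obj X\<rbrakk> \<Longrightarrow> \<pi>\<^sub>1 A B \<in> hom X (A \<otimes> B) B"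
    and pairing_hom:
      "\<lbrakk>f \<in> hom X C A; g \<in> hom X C B\<rbrakk> \<Longrightarrow> \<langle>f, g\<rangle> \<in> hom X C (A \<otimes> B)"
    and pairing_proj0: "\<lbrakk>f \<in> hom X C A; g \<in> hom X C B\<rbrakk> \<Longrightarrow> \<langle>f, g\<rangle> \<cdot> \<pi>\<^sub>0 A B = f"
    and pairing_proj1: "\<lbrakk>f \<in> hom X C A; g \<in> hom X C B\<rbrakk> \<Longrightarrow> \<langle>f, g\<rangle> \<cdot> \<pi>\<^sub>1 A B = g"
    and pairing_unique:
      "\<lbrakk>A \<in> obj X; B \<in> obj X; h \<in> hom X C (A \<otimes> B); h \<cdot> \<pi>\<^sub>0 A B = f; h \<cdot> \<pi>\<^sub>1 A B = g\<rbrakk>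
        \<Longrightarrow> h = \<langle>f, g\<rangle>"
    and proj0_additive: "\<lbrakk>A \<in> obj X; B \<in> obj X\<rbrakk> \<Longrightarrow> additive X (\<pi>\<^sub>0 A B)"
    and proj1_additive: "\<lbrakk>A \<in> obj X; B \<in> obj X\<rbrakk> \<Longrightarrow> additive X (\<pi>\<^sub>1 A B)"

context
  fixes X :: "('o, 'm, 'z) cartesian_left_additive_category_scheme" (structure)
begin

definition prod_map :: "'m \<Rightarrow> 'm \<Rightarrow> 'm" where
  "prod_map f g = \<langle>\<pi>\<^sub>0 (src X f) (src X g) \<cdot> f, \<pi>\<^sub>1 (src X f) (src X g) \<cdot> g\<rangle>"

definition sum_map :: "'o \<Rightarrow> 'm" where
  "sum_map A = \<pi>\<^sub>0 A A \<oplus> \<pi>\<^sub>1 A A"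

definition swap :: "'o \<Rightarrow> 'o \<Rightarrow> 'm" where
  "swap A B = \<langle>\<pi>\<^sub>1 A B, \<pi>\<^sub>0 A B\<rangle>"

definition ell :: "'o \<Rightarrow> 'o \<Rightarrow> 'o \<Rightarrow> 'o \<Rightarrow> 'm" where
  "ell A B C D = prod_map \<langle>\<one> A, \<zero> A B\<rangle> \<langle>\<zero> D C, \<one> D\<rangle>"

definition interchange :: "'o \<Rightarrow> 'o \<Rightarrow> 'o \<Rightarrow> 'o \<Rightarrow> 'm" where
  "interchange A B C D =
     \<langle>prod_map (\<pi>\<^sub>0 A B) (\<pi>\<^sub>0 C D), prod_map (\<pi>\<^sub>1 A B) (\<pi>\<^sub>1 C D)\<rangle>"

text \<open>
  \<open>assoc0 C A B\<close> and \<open>assoc1 C A B\<close> are the isomorphisms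
  \<open>\<beta> : C \<times> (A \<times> B) \<rightarrow> (C \<times> B) \<times> A\<close> and \<open>\<alpha> : C \<times> (A \<times> B) \<rightarrow> (C \<times> A) \<times> B\<close>,
  numbered by the factor of \<open>A \<times> B\<close> that stays outside the context; they are followed by
  their inverses.
\<close>

definition assoc0 :: "'o \<Rightarrow> 'o \<Rightarrow> 'o \<Rightarrow> 'm" where
  "assoc0 C A B = \<langle>prod_map (\<one> C) (\<pi>\<^sub>1 A B), \<pi>\<^sub>1 C (A \<otimes> B) \<cdot> \<pi>\<^sub>0 A B\<rangle>"

definition assoc1 :: "'o \<Rightarrow> 'o \<Rightarrow> 'o \<Rightarrow> 'm" where
  "assoc1 C A B = \<langle>prod_map (\<one> C) (\<pi>\<^sub>0 A B), \<pi>\<^sub>1 C (A \<otimes> B) \<cdot> \<pi>\<^sub>1 A B\<rangle>"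

definition assoc0_inv :: "'o \<Rightarrow> 'o \<Rightarrow> 'o \<Rightarrow> 'm" where
  "assoc0_inv C A B =
     \<langle>\<pi>\<^sub>0 (C \<otimes> B) A \<cdot> \<pi>\<^sub>0 C B, \<langle>\<pi>\<^sub>1 (C \<otimes> B) A, \<pi>\<^sub>0 (C \<otimes> B) A \<cdot> \<pi>\<^sub>1 C B\<rangle>\<rangle>"

definition assoc1_inv :: "'o \<Rightarrow> 'o \<Rightarrow> 'o \<Rightarrow> 'm" where
  "assoc1_inv C A B =
     \<langle>\<pi>\<^sub>0 (C \<otimes> A) B \<cdot> \<pi>\<^sub>0 C A, \<langle>\<pi>\<^sub>0 (C \<otimes> A) B \<cdot> \<pi>\<^sub>1 C A, \<pi>\<^sub>1 (C \<otimes> A) B\<rangle>\<rangle>"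

end

text \<open>
  \<open>curry C A f\<close> is the curry of \<open>f : C \<times> A \<rightarrow> B\<close>. Its arguments \<open>C\<close> and \<open>A\<close> cannot be
  recovered from \<open>f\<close>, since \<open>prod\<close> need not be injective on objects.
\<close>

record ('o, 'm) cartesian_closed_left_additive_category =
    "('o, 'm) cartesian_left_additive_category" +
  ihom :: "'o \<Rightarrow> 'o \<Rightarrow> 'o" ("\<lbrakk>_ \<Rightarrow> _\<rbrakk>\<index>")
  ev :: "'o \<Rightarrow> 'o \<Rightarrow> 'm" ("\<epsilon>\<index>")
  curry :: "'o \<Rightarrow> 'o \<Rightarrow> 'm \<Rightarrow> 'm" ("\<Lambda>\<index>")

locale cartesian_closed_left_additive_category = cartesian_left_additive_category X
  for X :: "('o, 'm, 'z) cartesian_closed_left_additive_category_scheme" (structure) +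
  assumes ihom_obj: "\<lbrakk>C \<in> obj X; A \<in> obj X\<rbrakk> \<Longrightarrow> \<lbrakk>C \<Rightarrow> A\<rbrakk> \<in> obj X"
    and ev_hom: "\<lbrakk>C \<in> obj X; A \<in> obj X\<rbrakk> \<Longrightarrow> \<epsilon> C A \<in> hom X (C \<otimes> \<lbrakk>C \<Rightarrow> A\<rbrakk>) A"
    and curry_hom:
      "\<lbrakk>C \<in> obj X; A \<in> obj X; f \<in> hom X (C \<otimes> A) B\<rbrakk> \<Longrightarrow> \<Lambda> C A f \<in> hom X A \<lbrakk>C \<Rightarrow> B\<rbrakk>"
    and curry_ev:
      "\<lbrakk>C \<in> obj X; A \<in> obj X; f \<in> hom X (C \<otimes> A) B\<rbrakk>
        \<Longrightarrow> prod_map X (\<one> C) (\<Lambda> C A f) \<cdot> \<epsilon> C B = f"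
    and curry_unique:
      "\<lbrakk>C \<in> obj X; A \<in> obj X; B \<in> obj X; g \<in> hom X A \<lbrakk>C \<Rightarrow> B\<rbrakk>;
        prod_map X (\<one> C) g \<cdot> \<epsilon> C B = f\<rbrakk> \<Longrightarrow> g = \<Lambda> C A f"
    and curry_add:
      "\<lbrakk>C \<in> obj X; A \<in> obj X; f \<in> hom X (C \<otimes> A) B; g \<in> hom X (C \<otimes> A) B\<rbrakk>
        \<Longrightarrow> \<Lambda> C A (f \<oplus> g) = \<Lambda> C A f \<oplus> \<Lambda> C A g"
    and curry_zero:
      "\<lbrakk>C \<in> obj X; A \<in> obj X; B \<in> obj X\<rbrakk>
        \<Longrightarrow> \<Lambda> C A (\<zero> (C \<otimes> A) B) = \<zero> A \<lbrakk>C \<Rightarrow> B\<rbrakk>"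

context
  fixes X :: "('o, 'm, 'z) cartesian_closed_left_additive_category_scheme" (structure)
begin

definition uncurry :: "'o \<Rightarrow> 'o \<Rightarrow> 'm \<Rightarrow> 'm" where
  "uncurry C B g = prod_map X (\<one> C) g \<cdot> \<epsilon> C B"

definition ihom_map :: "'m \<Rightarrow> 'm \<Rightarrow> 'm" where
  "ihom_map f g =
     (let C = src X f; D = tgt X f; A = src X g
      in \<Lambda> C \<lbrakk>D \<Rightarrow> A\<rbrakk> (prod_map X f (\<one> \<lbrakk>D \<Rightarrow> A\<rbrakk>) \<cdot> \<epsilon> D A \<cdot> g))"

definition eta :: "'o \<Rightarrow> 'o \<Rightarrow> 'm" where
  "eta C A = \<Lambda> C A (\<pi>\<^sub>1 C A)"

definition mu :: "'o \<Rightarrow> 'o \<Rightarrow> 'm" where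
  "mu C A =
     \<Lambda> C \<lbrakk>C \<Rightarrow> \<lbrakk>C \<Rightarrow> A\<rbrakk>\<rbrakk>
       (\<langle>\<pi>\<^sub>0 C \<lbrakk>C \<Rightarrow> \<lbrakk>C \<Rightarrow> A\<rbrakk>\<rbrakk>, \<epsilon> C \<lbrakk>C \<Rightarrow> A\<rbrakk>\<rangle> \<cdot> \<epsilon> C A)"

end

section \<open>Differential combinators\<close>

text \<open>
  Operators on hom-sets are total functions that are \<open>undefined\<close> away from their mathematical
  domain; equality of functions is then equality of combinators, so that combinators can
  be compared and counted as elements of a set.
\<close>

locale differential_combinator = cartesian_left_additive_category X
  for X :: "('o, 'm, 'z) cartesian_left_additive_category_scheme" (structure)
    and D :: "'m \<Rightarrow> 'm" +
  assumes D_hom: "f \<in> hom X A B \<Longrightarrow> D f \<in> hom X (A \<otimes> A) B"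
    and D_undefined: "f \<notin> arr X \<Longrightarrow> D f = undefined"
    and CD1_add: "\<lbrakk>f \<in> hom X A B; g \<in> hom X A B\<rbrakk> \<Longrightarrow> D (f \<oplus> g) = D f \<oplus> D g"
    and CD1_zero: "\<lbrakk>A \<in> obj X; B \<in> obj X\<rbrakk> \<Longrightarrow> D (\<zero> A B) = \<zero> (A \<otimes> A) B"
    and CD2_add:
      "f \<in> hom X A B \<Longrightarrow> prod_map X (\<one> A) (sum_map X A) \<cdot> D f =
         prod_map X (\<one> A) (\<pi>\<^sub>0 A A) \<cdot> D f \<oplus> prod_map X (\<one> A) (\<pi>\<^sub>1 A A) \<cdot> D f"
    and CD2_zero: "f \<in> hom X A B \<Longrightarrow> \<langle>\<one> A, \<zero> A A\<rangle> \<cdot> D f = \<zero> A B"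
    and CD3_ident: "A \<in> obj X \<Longrightarrow> D (\<one> A) = \<pi>\<^sub>1 A A"
    and CD3_proj0:
      "\<lbrakk>A \<in> obj X; B \<in> obj X\<rbrakk> \<Longrightarrow> D (\<pi>\<^sub>0 A B) = \<pi>\<^sub>1 (A \<otimes> B) (A \<otimes> B) \<cdot> \<pi>\<^sub>0 A B"
    and CD3_proj1:
      "\<lbrakk>A \<in> obj X; B \<in> obj X\<rbrakk> \<Longrightarrow> D (\<pi>\<^sub>1 A B) = \<pi>\<^sub>1 (A \<otimes> B) (A \<otimes> B) \<cdot> \<pi>\<^sub>1 A B"
    and CD4: "\<lbrakk>f \<in> hom X C A; g \<in> hom X C B\<rbrakk> \<Longrightarrow> D \<langle>f, g\<rangle> = \<langle>D f, D g\<rangle>"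
    and CD5:
      "\<lbrakk>f \<in> hom X A B; g \<in> hom X B C\<rbrakk> \<Longrightarrow> D (f \<cdot> g) = \<langle>\<pi>\<^sub>0 A A \<cdot> f, D f\<rangle> \<cdot> D g"
    and CD6: "f \<in> hom X A B \<Longrightarrow> ell X A A A A \<cdot> D (D f) = D f"
    and CD7: "f \<in> hom X A B \<Longrightarrow> interchange X A A A A \<cdot> D (D f) = D (D f)"

definition partial_derivative ::
    "('o, 'm, 'z) cartesian_left_additive_category_scheme \<Rightarrow> ('m \<Rightarrow> 'm) \<Rightarrow> 'o \<Rightarrow> 'o \<Rightarrow> 'm \<Rightarrow> 'm" where
  "partial_derivative X D C A f =
     \<langle>prod_map X (\<one>\<^bsub>X\<^esub> C) (\<pi>\<^sub>0\<^bsub>X\<^esub> A A), prod_map X (\<zero>\<^bsub>X\<^esub> C C) (\<pi>\<^sub>1\<^bsub>X\<^esub> A A)\<rangle>\<^bsub>X\<^esub> \<cdot>\<^bsub>X\<^esub> D f"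

definition CD_lambda ::
    "('o, 'm, 'z) cartesian_closed_left_additive_category_scheme \<Rightarrow> ('m \<Rightarrow> 'm) \<Rightarrow> bool" where
  "CD_lambda X D \<longleftrightarrow>
     (\<forall>A\<in>obj X. \<forall>B\<in>obj X. \<forall>C\<in>obj X. \<forall>f\<in>hom X (C \<otimes>\<^bsub>X\<^esub> A) B.
        D (\<Lambda>\<^bsub>X\<^esub> C A f) = \<Lambda>\<^bsub>X\<^esub> C (A \<otimes>\<^bsub>X\<^esub> A) (partial_derivative X D C A f))"

definition CD_ev ::
    "('o, 'm, 'z) cartesian_closed_left_additive_category_scheme \<Rightarrow> ('m \<Rightarrow> 'm) \<Rightarrow> bool" where
  "CD_ev X D \<longleftrightarrow>
     (\<forall>A\<in>obj X. \<forall>C\<in>obj X.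
        partial_derivative X D C \<lbrakk>C \<Rightarrow> A\<rbrakk>\<^bsub>X\<^esub> (\<epsilon>\<^bsub>X\<^esub> C A) =
          prod_map X (\<one>\<^bsub>X\<^esub> C) (\<pi>\<^sub>1\<^bsub>X\<^esub> \<lbrakk>C \<Rightarrow> A\<rbrakk>\<^bsub>X\<^esub> \<lbrakk>C \<Rightarrow> A\<rbrakk>\<^bsub>X\<^esub>) \<cdot>\<^bsub>X\<^esub> \<epsilon>\<^bsub>X\<^esub> C A)"

locale cartesian_closed_differential_category =
    cartesian_closed_left_additive_category X + differential_combinator X D
  for X :: "('o, 'm, 'z) cartesian_closed_left_additive_category_scheme" (structure)
    and D :: "'m \<Rightarrow> 'm" +
  assumes CD_lambda: "CD_lambda X D"

section \<open>Linearizing combinators\<close>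

locale linearizing_combinator = cartesian_left_additive_category X
  for X :: "('o, 'm, 'z) cartesian_left_additive_category_scheme" (structure)
    and L :: "'m \<Rightarrow> 'm" +
  assumes L_hom: "f \<in> hom X A B \<Longrightarrow> L f \<in> hom X A B"
    and L_undefined: "f \<notin> arr X \<Longrightarrow> L f = undefined"
    and L1_add: "\<lbrakk>f \<in> hom X A B; g \<in> hom X A B\<rbrakk> \<Longrightarrow> L (f \<oplus> g) = L f \<oplus> L g"
    and L1_zero: "\<lbrakk>A \<in> obj X; B \<in> obj X\<rbrakk> \<Longrightarrow> L (\<zero> A B) = \<zero> A B"
    and L2: "f \<in> arr X \<Longrightarrow> additive X (L f)"
    and L3_ident: "A \<in> obj X \<Longrightarrow> L (\<one> A) = \<one> A"
    and L3_proj0: "\<lbrakk>A \<in> obj X; B \<in> obj X\<rbrakk> \<Longrightarrow> L (\<pi>\<^sub>0 A B) = \<pi>\<^sub>0 A B"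
    and L3_proj1: "\<lbrakk>A \<in> obj X; B \<in> obj X\<rbrakk> \<Longrightarrow> L (\<pi>\<^sub>1 A B) = \<pi>\<^sub>1 A B"
    and L4: "\<lbrakk>f \<in> hom X C A; g \<in> hom X C B\<rbrakk> \<Longrightarrow> L \<langle>f, g\<rangle> = \<langle>L f, L g\<rangle>"
    and L5:
      "\<lbrakk>f \<in> hom X A B; g \<in> hom X B C\<rbrakk> \<Longrightarrow> L (f \<cdot> g) = L f \<cdot> L ((\<one> B \<oplus> \<zero> B A \<cdot> f) \<cdot> g)"
    and L6: "f \<in> arr X \<Longrightarrow> L (L f) = L f"

text \<open>
  \<open>L_part0 X L A B\<close> and \<open>L_part1 X L A B\<close> linearize \<open>f : A \<times> B \<rightarrow> C\<close> in its first and second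
  argument.
\<close>

context
  fixes X :: "('o, 'm, 'z) cartesian_closed_left_additive_category_scheme" (structure)
    and L :: "'m \<Rightarrow> 'm"
begin

definition L_part0 :: "'o \<Rightarrow> 'o \<Rightarrow> 'm \<Rightarrow> 'm" where
  "L_part0 A B f = swap X A B \<cdot> uncurry X B (tgt X f) (L (\<Lambda> B A (swap X B A \<cdot> f)))"

definition L_part1 :: "'o \<Rightarrow> 'o \<Rightarrow> 'm \<Rightarrow> 'm" where
  "L_part1 A B f = uncurry X A (tgt X f) (L (\<Lambda> A B f))"

end

locale exponentiable_linearizing_combinator =
    cartesian_closed_left_additive_category X + linearizing_combinator X L
  for X :: "('o, 'm, 'z) cartesian_closed_left_additive_category_scheme" (structure)
    and L :: "'m \<Rightarrow> 'm" +
  assumes EL1_eta: "\<lbrakk>C \<in> obj X; A \<in> obj X\<rbrakk> \<Longrightarrow> L (eta X C A) = eta X C A"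
    and EL1_mu: "\<lbrakk>C \<in> obj X; A \<in> obj X\<rbrakk> \<Longrightarrow> L (mu X C A) = mu X C A"
    and EL2: "\<lbrakk>f \<in> arr X; g \<in> arr X\<rbrakk> \<Longrightarrow> L (ihom_map X f g) = ihom_map X f (L g)"
    and EL3:
      "\<lbrakk>A \<in> obj X; B \<in> obj X; f \<in> hom X (A \<otimes> B) C\<rbrakk>
        \<Longrightarrow> L_part0 X L A B (L_part1 X L A B f) = L_part1 X L A B (L_part0 X L A B f)"

section \<open>Systems of linearizing combinators\<close>

text \<open>
  \<open>L C A f\<close> is the value of the operator with context \<open>C\<close> at \<open>f : C \<times> A \<rightarrow> B\<close>. The object \<open>A\<close>
  is an argument because \<open>prod\<close> need not be injective on objects.
\<close>

definition sys_part0 ::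
    "('o, 'm, 'z) cartesian_left_additive_category_scheme \<Rightarrow> ('o \<Rightarrow> 'o \<Rightarrow> 'm \<Rightarrow> 'm)
      \<Rightarrow> 'o \<Rightarrow> 'o \<Rightarrow> 'o \<Rightarrow> 'm \<Rightarrow> 'm" where
  "sys_part0 X L C A B f =
     assoc0 X C A B \<cdot>\<^bsub>X\<^esub> L (C \<otimes>\<^bsub>X\<^esub> B) A (assoc0_inv X C A B \<cdot>\<^bsub>X\<^esub> f)"

definition sys_part1 ::
    "('o, 'm, 'z) cartesian_left_additive_category_scheme \<Rightarrow> ('o \<Rightarrow> 'o \<Rightarrow> 'm \<Rightarrow> 'm)
      \<Rightarrow> 'o \<Rightarrow> 'o \<Rightarrow> 'o \<Rightarrow> 'm \<Rightarrow> 'm" where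
  "sys_part1 X L C A B f =
     assoc1 X C A B \<cdot>\<^bsub>X\<^esub> L (C \<otimes>\<^bsub>X\<^esub> A) B (assoc1_inv X C A B \<cdot>\<^bsub>X\<^esub> f)"

locale linearizing_system = cartesian_left_additive_category X
  for X :: "('o, 'm, 'z) cartesian_left_additive_category_scheme" (structure)
    and L :: "'o \<Rightarrow> 'o \<Rightarrow> 'm \<Rightarrow> 'm" +
  assumes sys_hom:
      "\<lbrakk>C \<in> obj X; A \<in> obj X; f \<in> hom X (C \<otimes> A) B\<rbrakk> \<Longrightarrow> L C A f \<in> hom X (C \<otimes> A) B"
    and sys_undefined:
      "\<not> (C \<in> obj X \<and> A \<in> obj X \<and> f \<in> arr X \<and> src X f = C \<otimes> A) \<Longrightarrow> L C A f = undefined"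
    and sys_L1_add:
      "\<lbrakk>C \<in> obj X; A \<in> obj X; f \<in> hom X (C \<otimes> A) B; g \<in> hom X (C \<otimes> A) B\<rbrakk>
        \<Longrightarrow> L C A (f \<oplus> g) = L C A f \<oplus> L C A g"
    and sys_L1_zero:
      "\<lbrakk>C \<in> obj X; A \<in> obj X; B \<in> obj X\<rbrakk> \<Longrightarrow> L C A (\<zero> (C \<otimes> A) B) = \<zero> (C \<otimes> A) B"
    and sys_L2_add:
      "\<lbrakk>C \<in> obj X; A \<in> obj X; f \<in> hom X (C \<otimes> A) B\<rbrakk>
        \<Longrightarrow> prod_map X (\<one> C) (sum_map X A) \<cdot> L C A f =
          prod_map X (\<one> C) (\<pi>\<^sub>0 A A) \<cdot> L C A f \<oplus> prod_map X (\<one> C) (\<pi>\<^sub>1 A A) \<cdot> L C A f"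
    and sys_L2_zero:
      "\<lbrakk>C \<in> obj X; A \<in> obj X; f \<in> hom X (C \<otimes> A) B\<rbrakk>
        \<Longrightarrow> \<langle>\<pi>\<^sub>0 C A, \<zero> (C \<otimes> A) A\<rangle> \<cdot> L C A f = \<zero> (C \<otimes> A) B"
    and sys_L3:
      "\<lbrakk>C \<in> obj X; A \<in> obj X\<rbrakk> \<Longrightarrow> L C A (\<pi>\<^sub>1 C A) = \<pi>\<^sub>1 C A"
    and sys_L3_proj0:
      "\<lbrakk>C \<in> obj X; A \<in> obj X; B \<in> obj X\<rbrakk>
        \<Longrightarrow> L C (A \<otimes> B) (\<pi>\<^sub>1 C (A \<otimes> B) \<cdot> \<pi>\<^sub>0 A B) = \<pi>\<^sub>1 C (A \<otimes> B) \<cdot> \<pi>\<^sub>0 A B"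
    and sys_L3_proj1:
      "\<lbrakk>C \<in> obj X; A \<in> obj X; B \<in> obj X\<rbrakk>
        \<Longrightarrow> L C (A \<otimes> B) (\<pi>\<^sub>1 C (A \<otimes> B) \<cdot> \<pi>\<^sub>1 A B) = \<pi>\<^sub>1 C (A \<otimes> B) \<cdot> \<pi>\<^sub>1 A B"
    and sys_L4:
      "\<lbrakk>C \<in> obj X; A \<in> obj X; f \<in> hom X (C \<otimes> A) B; g \<in> hom X (C \<otimes> A) D\<rbrakk>
        \<Longrightarrow> L C A \<langle>f, g\<rangle> = \<langle>L C A f, L C A g\<rangle>"
    and sys_L5:
      "\<lbrakk>C \<in> obj X; A \<in> obj X; B \<in> obj X; f \<in> hom X (C \<otimes> A) B; g \<in> hom X (C \<otimes> B) D\<rbrakk>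
        \<Longrightarrow> L C A (\<langle>\<pi>\<^sub>0 C A, f\<rangle> \<cdot> g) =
          \<langle>\<pi>\<^sub>0 C A, L C A f\<rangle> \<cdot>
            L C B (\<langle>\<pi>\<^sub>0 C B, \<pi>\<^sub>1 C B \<oplus> \<langle>\<pi>\<^sub>0 C B, \<zero> (C \<otimes> B) A\<rangle> \<cdot> f\<rangle> \<cdot> g)"
    and sys_L6:
      "\<lbrakk>C \<in> obj X; A \<in> obj X; f \<in> hom X (C \<otimes> A) B\<rbrakk> \<Longrightarrow> L C A (L C A f) = L C A f"
    and sys_L7:
      "\<lbrakk>C \<in> obj X; A \<in> obj X; B \<in> obj X; f \<in> hom X (C \<otimes> (A \<otimes> B)) D\<rbrakk>
        \<Longrightarrow> sys_part1 X L C A B (sys_part0 X L C A B f) =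
          sys_part0 X L C A B (sys_part1 X L C A B f)"
    and sys_L8:
      "\<lbrakk>C \<in> obj X; A \<in> obj X; h \<in> hom X C' C; f \<in> hom X (C \<otimes> A) B\<rbrakk>
        \<Longrightarrow> prod_map X h (\<one> A) \<cdot> L C A f = L C' A (prod_map X h (\<one> A) \<cdot> f)"

section \<open>The comparison maps\<close>

text \<open>
  Passage to the combinators determined by a given one. In terms of a derivative, \<open>L[f]\<close> is the
  derivative at \<open>0\<close>, \<open>L\<^sup>C[f]\<close> is the derivative at \<open>0\<close> in the second argument, and
  \<open>D[f]\<close> is recovered by linearizing \<open>(a, b) \<mapsto> f (a + b)\<close> in \<open>b\<close>:
  \<^item> \<open>L[f] = \<langle>0,1\<rangle> D[f]\<close>, \<open>L\<^sup>C[f] = \<ell> D[f]\<close> and \<open>D[f] = L\<^sup>A[\<oplus>\<^sub>A f]\<close> for \<open>f : A \<rightarrow> B\<close>;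
  \<^item> \<open>L[f] = \<langle>0,1\<rangle> L\<^sup>\<top>[\<pi>\<^sub>1 f]\<close> and \<open>L\<^sup>C[f] = \<lambda>\<^sup>-\<^sup>1(L[\<lambda>(f)])\<close>;
  \<^item> \<open>D[f] = \<lambda>\<^sup>-\<^sup>1(L[\<lambda>(\<oplus>\<^sub>A f)])\<close>.
\<close>

context
  fixes X :: "('o, 'm, 'z) cartesian_left_additive_category_scheme" (structure)
begin

definition lin_of_diff :: "('m \<Rightarrow> 'm) \<Rightarrow> 'm \<Rightarrow> 'm" where
  "lin_of_diff D f =
     (if f \<in> arr X then \<langle>\<zero> (src X f) (src X f), \<one> (src X f)\<rangle> \<cdot> D f else undefined)"

definition sys_of_diff :: "('m \<Rightarrow> 'm) \<Rightarrow> 'o \<Rightarrow> 'o \<Rightarrow> 'm \<Rightarrow> 'm" where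
  "sys_of_diff D C A f =
     (if C \<in> obj X \<and> A \<in> obj X \<and> f \<in> arr X \<and> src X f = C \<otimes> A
      then ell X C A C A \<cdot> D f else undefined)"

definition diff_of_sys :: "('o \<Rightarrow> 'o \<Rightarrow> 'm \<Rightarrow> 'm) \<Rightarrow> 'm \<Rightarrow> 'm" where
  "diff_of_sys L f =
     (if f \<in> arr X then L (src X f) (src X f) (sum_map X (src X f) \<cdot> f) else undefined)"

definition lin_of_sys :: "('o \<Rightarrow> 'o \<Rightarrow> 'm \<Rightarrow> 'm) \<Rightarrow> 'm \<Rightarrow> 'm" where
  "lin_of_sys L f =
     (if f \<in> arr X
      then \<langle>\<zero> (src X f) \<top>, \<one> (src X f)\<rangle> \<cdot> L \<top> (src X f) (\<pi>\<^sub>1 \<top> (src X f) \<cdot> f)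
      else undefined)"

end

context
  fixes X :: "('o, 'm, 'z) cartesian_closed_left_additive_category_scheme" (structure)
begin

definition sys_of_lin :: "('m \<Rightarrow> 'm) \<Rightarrow> 'o \<Rightarrow> 'o \<Rightarrow> 'm \<Rightarrow> 'm" where
  "sys_of_lin L C A f =
     (if C \<in> obj X \<and> A \<in> obj X \<and> f \<in> arr X \<and> src X f = C \<otimes> A
      then uncurry X C (tgt X f) (L (\<Lambda> C A f)) else undefined)"

definition diff_of_lin :: "('m \<Rightarrow> 'm) \<Rightarrow> 'm \<Rightarrow> 'm" where
  "diff_of_lin L f =
     (if f \<in> arr X
      then uncurry X (src X f) (tgt X f)
             (L (\<Lambda> (src X f) (src X f) (sum_map X (src X f) \<cdot> f)))
      else undefined)"

end

locale closed_linearizing_system =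
    cartesian_closed_left_additive_category X + linearizing_system X L
  for X :: "('o, 'm, 'z) cartesian_closed_left_additive_category_scheme" (structure)
    and L :: "'o \<Rightarrow> 'o \<Rightarrow> 'm \<Rightarrow> 'm" +
  assumes L_lambda:
      "\<lbrakk>C \<in> obj X; A \<in> obj X; f \<in> hom X (C \<otimes> A) B\<rbrakk>
        \<Longrightarrow> lin_of_sys X L (\<Lambda> C A f) = \<Lambda> C A (L C A f)"

definition mutually_inverse ::
    "('a \<Rightarrow> 'b) \<Rightarrow> ('b \<Rightarrow> 'a) \<Rightarrow> 'a set \<Rightarrow> 'b set \<Rightarrow> bool" where
  "mutually_inverse F G S T \<longleftrightarrow>
     bij_betw F S T \<and> bij_betw G T S \<and> (\<forall>s\<in>S. G (F s) = s) \<and> (\<forall>t\<in>T. F (G t) = t)"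

end

theory Submission
  imports Defs
begin

text \<open>
  Read \<open>D[f](x, v)\<close> as the derivative of \<open>f\<close> at \<open>x\<close> in direction \<open>v\<close>. Closed structure allows a
  single operator \<open>L\<close>, the derivative at \<open>0\<close>, to carry all the information in \<open>D\<close>: to differentiate
  at a point other than \<open>0\<close>, or in one argument only, move the remaining arguments into an internal
  hom, linearize there, and uncurry. So \<open>L\<^sup>C[f] = \<lambda>\<^sup>-\<^sup>1(L[\<lambda>(f)])\<close> linearizes in the presence of a
  context \<open>C\<close>, and \<open>D[f](x, v)\<close> is the linearization of \<open>f(x + v)\<close> in \<open>v\<close> with \<open>x\<close> as context.

  The three structures are compared along the cycle
  \<open>D \<mapsto> L \<mapsto> (L\<^sup>C)\<^sub>C \<mapsto> D\<close> given by \<open>lin_of_diff\<close>, \<open>sys_of_lin\<close> and \<open>diff_of_sys\<close>. Each of the three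
  maps lands in the right class (\<open>exponentiable_lin_of_diff\<close>, \<open>closed_sys_of_lin\<close>,
  \<open>differential_combinator_diff_of_sys\<close> with \<open>CD_lambda_diff_of_sys\<close>), and the remaining comparison
  maps are composites of two consecutive ones: \<open>sys_of_lin_of_diff\<close>, \<open>lin_of_diff_of_sys\<close>,
  \<open>diff_of_sys_of_lin\<close>. What is left are the round trips \<open>diff_of_sys_of_diff\<close>, \<open>sys_of_lin_of_sys\<close>
  and \<open>lin_of_sys_of_lin\<close>, each a short computation; formal manipulation of the cycle yields all the
  bijections.

  Going from \<open>D\<close> to \<open>L\<close>, the axioms follow by evaluating the chain rule at \<open>0\<close>; the symmetry [EL.3] is
  the symmetry [CD.7] of second derivatives. Going from \<open>L\<close> to a system, the chain rule [L.5] in a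
  context comes from the one without context, because composition in context \<open>C\<close> is
  \<open>\<lambda>(\<langle>\<pi>\<^sub>0,f\<rangle>g) = \<lambda>(f) [1,\<lambda>(g)] \<mu>\<close> and \<open>\<mu>\<close> is linear by [EL.1], while [EL.2] lets \<open>L\<close> pass
  under \<open>[1,-]\<close>. For both [L.7] and [CD.\<lambda>], the key fact is \<open>M_of_ev_in_larger_context\<close>: linearizing in
  a context \<open>C \<times> A\<close> agrees with linearizing a curried map in the context \<open>A\<close> and uncurrying.
  Going from a system to \<open>D\<close>, the second derivative \<open>D[D[f]]((x,u),(y,v))\<close> splits by additivity into
  the pure term \<open>D[f](x,v)\<close> and a mixed term, which is a double linearization of \<open>f(x + y + u)\<close> in \<open>y\<close>
  and \<open>u\<close>; [CD.6] reads off the pure term, and [CD.7] is [L.7] for the mixed term.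

  The equations are verified on generalized elements: composites are rewritten into
  left-associated form, so that \<open>x \<cdot> f \<cdot> g\<close> reads as \<open>g(f(x))\<close>, precomposition is pushed through
  pairings and sums, and the typing conditions are discharged by rewriting sources and targets.
\<close>

section \<open>Rewriting with generalized elements\<close>

context category
begin

text \<open>
  Membership in a hom-set is split into separate equations for source and target, since as rewrite
  rules these compute the intermediate objects of a composite, which a hom-set premise would leave
  to be guessed.
\<close>

lemma hom_iff:
  "f \<in> hom X A B \<longleftrightarrow> f \<in> arr X \<and> src X f = A \<and> tgt X f = B \<and> A \<in> obj X \<and> B \<in> obj X"
  using src_obj tgt_obj by (auto simp: hom_def)

lemma src_tgt_obj [simp]:
  "f \<in> arr X \<Longrightarrow> src X f \<in> obj X" "f \<in> arr X \<Longrightarrow> tgt X f \<in> obj X"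
  by (simp_all add: src_obj tgt_obj)

lemma ident_typing [simp]:
  assumes "A \<in> obj X"
  shows "\<one> A \<in> arr X" "src X (\<one> A) = A" "tgt X (\<one> A) = A"
  using ident_hom[OF assms] by (auto simp: hom_iff)

lemma compose_typing [simp]:
  assumes "f \<in> arr X" "g \<in> arr X" "tgt X f = src X g"
  shows "f \<cdot> g \<in> arr X" "src X (f \<cdot> g) = src X f" "tgt X (f \<cdot> g) = tgt X g"
  using compose_hom[of f "src X f" "tgt X f" g "tgt X g"] assms by (auto simp: hom_iff)

lemma ident_compose [simp]:
  "f \<in> arr X \<Longrightarrow> src X f = A \<Longrightarrow> \<one> A \<cdot> f = f"
  "f \<in> arr X \<Longrightarrow> tgt X f = B \<Longrightarrow> f \<cdot> \<one> B = f"
  using ident_left[of f A "tgt X f"] ident_right[of f "src X f" B] by (auto simp: hom_iff)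

lemma compose_left_assoc [simp]:
  assumes "f \<in> arr X" "g \<in> arr X" "h \<in> arr X" "tgt X f = src X g" "tgt X g = src X h"
  shows "f \<cdot> (g \<cdot> h) = (f \<cdot> g) \<cdot> h"
  using compose_assoc[of f "src X f" "tgt X f" g "tgt X g" h "tgt X h"] assms
  by (auto simp: hom_iff)

end

context left_additive_category
begin

lemma zero_typing [simp]:
  assumes "A \<in> obj X" "B \<in> obj X"
  shows "\<zero> A B \<in> arr X" "src X (\<zero> A B) = A" "tgt X (\<zero> A B) = B"
  using zero_hom[OF assms] by (auto simp: hom_iff)

lemma add_typing [simp]:
  assumes "f \<in> arr X" "g \<in> arr X" "src X f = src X g" "tgt X f = tgt X g"
  shows "f \<oplus> g \<in> arr X" "src X (f \<oplus> g) = src X g" "tgt X (f \<oplus> g) = tgt X g"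
  using add_hom[of f "src X f" "tgt X f" g] assms by (auto simp: hom_iff)

lemma zero_add_simps [simp]:
  "\<lbrakk>f \<in> arr X; src X f = A; tgt X f = B\<rbrakk> \<Longrightarrow> \<zero> A B \<oplus> f = f"
  "\<lbrakk>f \<in> arr X; src X f = A; tgt X f = B\<rbrakk> \<Longrightarrow> f \<oplus> \<zero> A B = f"
  using zero_add[of f A B] add_commute[of f A B "\<zero> A B"] by (auto simp: hom_iff)

lemma compose_add_simps [simp]:
  "\<lbrakk>f \<in> arr X; g \<in> arr X; h \<in> arr X; tgt X f = src X g; src X g = src X h; tgt X g = tgt X h\<rbrakk>
    \<Longrightarrow> f \<cdot> (g \<oplus> h) = f \<cdot> g \<oplus> f \<cdot> h"
  using compose_add[of f "src X f" "tgt X f" g "tgt X g" h] by (auto simp: hom_iff)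

lemma compose_zero_simps [simp]:
  "\<lbrakk>f \<in> arr X; tgt X f = B; C \<in> obj X\<rbrakk> \<Longrightarrow> f \<cdot> \<zero> B C = \<zero> (src X f) C"
  using compose_zero[of f "src X f" B C] by (auto simp: hom_iff)

lemma add_swap:
  "\<lbrakk>f \<in> arr X; g \<in> arr X; src X f = src X g; tgt X f = tgt X g\<rbrakk> \<Longrightarrow> f \<oplus> g = g \<oplus> f"
  using add_commute[of f "src X f" "tgt X f" g] by (auto simp: hom_iff)

lemma add_right_assoc:
  "\<lbrakk>f \<in> arr X; g \<in> arr X; h \<in> arr X; src X f = src X g; tgt X f = tgt X g;
    src X g = src X h; tgt X g = tgt X h\<rbrakk> \<Longrightarrow> (f \<oplus> g) \<oplus> h = f \<oplus> (g \<oplus> h)"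
  using add_assoc[of f "src X f" "tgt X f" g h] by (auto simp: hom_iff)

lemma additiveD:
  assumes "additive X k"
  shows "k \<in> arr X"
    "\<lbrakk>A \<in> obj X; src X k = B\<rbrakk> \<Longrightarrow> \<zero> A B \<cdot> k = \<zero> A (tgt X k)"
    "\<lbrakk>g \<in> arr X; h \<in> arr X; src X g = src X h; tgt X g = src X k; tgt X h = src X k\<rbrakk>
      \<Longrightarrow> (g \<oplus> h) \<cdot> k = g \<cdot> k \<oplus> h \<cdot> k"
proof -
  show "k \<in> arr X" "\<lbrakk>A \<in> obj X; src X k = B\<rbrakk> \<Longrightarrow> \<zero> A B \<cdot> k = \<zero> A (tgt X k)"
    using assms by (auto simp: additive_def)
  show "(g \<oplus> h) \<cdot> k = g \<cdot> k \<oplus> h \<cdot> k"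
    if "g \<in> arr X" "h \<in> arr X" "src X g = src X h" "tgt X g = src X k" "tgt X h = src X k"
  proof -
    have "g \<in> hom X (src X h) (src X k)" "h \<in> hom X (src X h) (src X k)"
      using that by (auto simp: hom_def)
    then show ?thesis using assms src_obj[OF that(2)] unfolding additive_def by blast
  qed
qed

end

context cartesian_left_additive_category
begin

lemma terminal_obj_simp [simp]: "\<top> \<in> obj X"
  by (rule terminal_obj)

lemma prod_obj_simp [simp]: "\<lbrakk>A \<in> obj X; B \<in> obj X\<rbrakk> \<Longrightarrow> A \<otimes> B \<in> obj X"
  by (rule prod_obj)

lemma proj_typing [simp]:
  assumes "A \<in> obj X" "B \<in> obj X"
  shows "\<pi>\<^sub>0 A B \<in> arr X" "src X (\<pi>\<^sub>0 A B) = A \<otimes> B" "tgt X (\<pi>\<^sub>0 A B) = A"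
    "\<pi>\<^sub>1 A B \<in> arr X" "src X (\<pi>\<^sub>1 A B) = A \<otimes> B" "tgt X (\<pi>\<^sub>1 A B) = B"
  using proj0_hom[OF assms] proj1_hom[OF assms] by (auto simp: hom_iff)

lemma pairing_typing [simp]:
  assumes "f \<in> arr X" "g \<in> arr X" "src X f = src X g"
  shows "\<langle>f, g\<rangle> \<in> arr X" "src X \<langle>f, g\<rangle> = src X g" "tgt X \<langle>f, g\<rangle> = tgt X f \<otimes> tgt X g"
  using pairing_hom[of f "src X f" "tgt X f" g "tgt X g"] assms by (auto simp: hom_iff)

lemma pairing_proj [simp]:
  assumes "f \<in> arr X" "g \<in> arr X" "src X f = src X g" "tgt X f = A" "tgt X g = B"
  shows "\<langle>f, g\<rangle> \<cdot> \<pi>\<^sub>0 A B = f" "\<langle>f, g\<rangle> \<cdot> \<pi>\<^sub>1 A B = g"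
  using pairing_proj0[of f "src X f" A g B] pairing_proj1[of f "src X f" A g B] assms
  by (auto simp: hom_iff)

lemma pairing_eta [simp]:
  "\<lbrakk>A \<in> obj X; B \<in> obj X\<rbrakk> \<Longrightarrow> \<langle>\<pi>\<^sub>0 A B, \<pi>\<^sub>1 A B\<rangle> = \<one> (A \<otimes> B)"
  "\<lbrakk>x \<in> arr X; tgt X x = A \<otimes> B; A \<in> obj X; B \<in> obj X\<rbrakk>
    \<Longrightarrow> \<langle>x \<cdot> \<pi>\<^sub>0 A B, x \<cdot> \<pi>\<^sub>1 A B\<rangle> = x"
  using pairing_unique[of A B "\<one> (A \<otimes> B)" "A \<otimes> B"] pairing_unique[of A B x "src X x"]
  by (auto simp: hom_iff)

lemma pairing_ext:
  assumes "f \<in> arr X" "g \<in> arr X" "src X f = src X g" "tgt X f = A \<otimes> B" "tgt X g = A \<otimes> B"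
    "A \<in> obj X" "B \<in> obj X"
    "f \<cdot> \<pi>\<^sub>0 A B = g \<cdot> \<pi>\<^sub>0 A B" "f \<cdot> \<pi>\<^sub>1 A B = g \<cdot> \<pi>\<^sub>1 A B"
  shows "f = g"
  using pairing_eta(2)[OF assms(1,4,6,7)] pairing_eta(2)[OF assms(2,5,6,7)] assms(8,9) by metis

lemma proj_add [simp]:
  assumes "A \<in> obj X" "B \<in> obj X" "g \<in> arr X" "h \<in> arr X" "src X g = src X h"
    "tgt X g = A \<otimes> B" "tgt X h = A \<otimes> B"
  shows "(g \<oplus> h) \<cdot> \<pi>\<^sub>0 A B = g \<cdot> \<pi>\<^sub>0 A B \<oplus> h \<cdot> \<pi>\<^sub>0 A B"
    "(g \<oplus> h) \<cdot> \<pi>\<^sub>1 A B = g \<cdot> \<pi>\<^sub>1 A B \<oplus> h \<cdot> \<pi>\<^sub>1 A B"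
  using additiveD(3)[OF proj0_additive[OF assms(1,2)], of g h]
    additiveD(3)[OF proj1_additive[OF assms(1,2)], of g h] assms by simp_all

lemma zero_proj [simp]:
  assumes "A \<in> obj X" "B \<in> obj X" "Z \<in> obj X"
  shows "\<zero> Z (A \<otimes> B) \<cdot> \<pi>\<^sub>0 A B = \<zero> Z A" "\<zero> Z (A \<otimes> B) \<cdot> \<pi>\<^sub>1 A B = \<zero> Z B"
  using additiveD(2)[OF proj0_additive[OF assms(1,2)], of Z "A \<otimes> B"]
    additiveD(2)[OF proj1_additive[OF assms(1,2)], of Z "A \<otimes> B"] assms by simp_all

lemma compose_pairing [simp]:
  assumes "x \<in> arr X" "f \<in> arr X" "g \<in> arr X" "src X f = src X g" "tgt X x = src X f"
  shows "x \<cdot> \<langle>f, g\<rangle> = \<langle>x \<cdot> f, x \<cdot> g\<rangle>"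
proof (rule pairing_ext[of _ _ "tgt X f" "tgt X g"])
  have "(x \<cdot> \<langle>f, g\<rangle>) \<cdot> \<pi>\<^sub>0 (tgt X f) (tgt X g) = x \<cdot> (\<langle>f, g\<rangle> \<cdot> \<pi>\<^sub>0 (tgt X f) (tgt X g))"
    using assms by (simp del: pairing_proj)
  then show "(x \<cdot> \<langle>f, g\<rangle>) \<cdot> \<pi>\<^sub>0 (tgt X f) (tgt X g) = \<langle>x \<cdot> f, x \<cdot> g\<rangle> \<cdot> \<pi>\<^sub>0 (tgt X f) (tgt X g)"
    using assms by simp
  have "(x \<cdot> \<langle>f, g\<rangle>) \<cdot> \<pi>\<^sub>1 (tgt X f) (tgt X g) = x \<cdot> (\<langle>f, g\<rangle> \<cdot> \<pi>\<^sub>1 (tgt X f) (tgt X g))"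
    using assms by (simp del: pairing_proj)
  then show "(x \<cdot> \<langle>f, g\<rangle>) \<cdot> \<pi>\<^sub>1 (tgt X f) (tgt X g) = \<langle>x \<cdot> f, x \<cdot> g\<rangle> \<cdot> \<pi>\<^sub>1 (tgt X f) (tgt X g)"
    using assms by simp
qed (use assms in simp_all)

lemma pairing_add [simp]:
  assumes "a \<in> arr X" "b \<in> arr X" "c \<in> arr X" "d \<in> arr X" "src X a = src X b"
    "src X c = src X d" "src X b = src X c" "tgt X a = tgt X c" "tgt X b = tgt X d"
  shows "\<langle>a, b\<rangle> \<oplus> \<langle>c, d\<rangle> = \<langle>a \<oplus> c, b \<oplus> d\<rangle>"
  by (rule pairing_ext[of _ _ "tgt X c" "tgt X d"]) (use assms in simp_all)

lemma pairing_zero [simp]: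
  assumes "A \<in> obj X" "B \<in> obj X" "Z \<in> obj X"
  shows "\<langle>\<zero> Z A, \<zero> Z B\<rangle> = \<zero> Z (A \<otimes> B)"
  by (rule pairing_ext[of _ _ A B]) (use assms in simp_all)

lemma prod_map_eq:
  "\<lbrakk>f \<in> arr X; g \<in> arr X; src X f = A; src X g = B\<rbrakk>
    \<Longrightarrow> prod_map X f g = \<langle>\<pi>\<^sub>0 A B \<cdot> f, \<pi>\<^sub>1 A B \<cdot> g\<rangle>"
  by (simp add: prod_map_def)

lemma sum_map_typing [simp]:
  assumes "A \<in> obj X"
  shows "sum_map X A \<in> arr X" "src X (sum_map X A) = A \<otimes> A" "tgt X (sum_map X A) = A"
  using assms by (simp_all add: sum_map_def)

lemma at_sum_map [simp]:
  assumes "x \<in> arr X" "y \<in> arr X" "src X x = src X y" "tgt X x = A" "tgt X y = A"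
  shows "\<langle>x, y\<rangle> \<cdot> sum_map X A = x \<oplus> y"
proof -
  have "A \<in> obj X" using assms by auto
  then show ?thesis using assms by (simp add: sum_map_def)
qed

end

context cartesian_closed_left_additive_category
begin

lemma ihom_obj_simp [simp]: "\<lbrakk>C \<in> obj X; A \<in> obj X\<rbrakk> \<Longrightarrow> \<lbrakk>C \<Rightarrow> A\<rbrakk> \<in> obj X"
  by (rule ihom_obj)

lemma ev_typing [simp]:
  assumes "C \<in> obj X" "A \<in> obj X"
  shows "\<epsilon> C A \<in> arr X" "src X (\<epsilon> C A) = C \<otimes> \<lbrakk>C \<Rightarrow> A\<rbrakk>" "tgt X (\<epsilon> C A) = A"
  using ev_hom[OF assms] by (auto simp: hom_iff)

lemma curry_typing [simp]:
  assumes "C \<in> obj X" "A \<in> obj X" "f \<in> arr X" "src X f = C \<otimes> A"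
  shows "\<Lambda> C A f \<in> arr X" "src X (\<Lambda> C A f) = A" "tgt X (\<Lambda> C A f) = \<lbrakk>C \<Rightarrow> tgt X f\<rbrakk>"
  using curry_hom[of C A f "tgt X f"] assms by (auto simp: hom_iff)

text \<open>
  The \<open>\<beta>\<close>-rule on generalized elements: evaluating the function \<open>y \<cdot> \<lambda>(f)\<close> at \<open>x\<close> gives \<open>f(x, y)\<close>. The
  first form is the case \<open>y = 1\<close>, where normalization has erased the composition.
\<close>

lemma ev_curry [simp]:
  assumes "C \<in> obj X" "A \<in> obj X" "f \<in> arr X" "src X f = C \<otimes> A" "tgt X f = B"
    "x \<in> arr X" "tgt X x = C"
  shows "src X x = A \<Longrightarrow> \<langle>x, \<Lambda> C A f\<rangle> \<cdot> \<epsilon> C B = \<langle>x, \<one> A\<rangle> \<cdot> f"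
    "\<lbrakk>y \<in> arr X; tgt X y = A; src X x = src X y\<rbrakk>
      \<Longrightarrow> \<langle>x, y \<cdot> \<Lambda> C A f\<rangle> \<cdot> \<epsilon> C B = \<langle>x, y\<rangle> \<cdot> f"
proof -
  have B: "B \<in> obj X" using assms by auto
  have key: "\<langle>x, y \<cdot> \<Lambda> C A f\<rangle> \<cdot> \<epsilon> C B = \<langle>x, y\<rangle> \<cdot> f"
    if "y \<in> arr X" "tgt X y = A" "src X x = src X y" for y
  proof -
    have "\<langle>x, y\<rangle> \<cdot> f = \<langle>x, y\<rangle> \<cdot> (prod_map X (\<one> C) (\<Lambda> C A f) \<cdot> \<epsilon> C B)"
      using curry_ev[of C A f B] assms B by (simp add: hom_iff)
    also have "\<dots> = \<langle>x, y \<cdot> \<Lambda> C A f\<rangle> \<cdot> \<epsilon> C B"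
      using assms B that by (simp add: prod_map_eq)
    finally show ?thesis by simp
  qed
  show "\<lbrakk>y \<in> arr X; tgt X y = A; src X x = src X y\<rbrakk>
      \<Longrightarrow> \<langle>x, y \<cdot> \<Lambda> C A f\<rangle> \<cdot> \<epsilon> C B = \<langle>x, y\<rangle> \<cdot> f"
    by (rule key)
  show "src X x = A \<Longrightarrow> \<langle>x, \<Lambda> C A f\<rangle> \<cdot> \<epsilon> C B = \<langle>x, \<one> A\<rangle> \<cdot> f"
    using key[of "\<one> A"] assms B by simp
qed

lemma uncurry_eq:
  "\<lbrakk>g \<in> arr X; src X g = A; C \<in> obj X\<rbrakk>
    \<Longrightarrow> uncurry X C B g = \<langle>\<pi>\<^sub>0 C A, \<pi>\<^sub>1 C A \<cdot> g\<rangle> \<cdot> \<epsilon> C B"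
  by (auto simp: uncurry_def prod_map_eq)

lemma curry_eqI:
  assumes "C \<in> obj X" "A \<in> obj X" "B \<in> obj X" "g \<in> arr X" "src X g = A" "tgt X g = \<lbrakk>C \<Rightarrow> B\<rbrakk>"
    "\<langle>\<pi>\<^sub>0 C A, \<pi>\<^sub>1 C A \<cdot> g\<rangle> \<cdot> \<epsilon> C B = f"
  shows "g = \<Lambda> C A f"
  using curry_unique[of C A B g f] assms by (simp add: hom_iff prod_map_eq)

lemma ihom_ext:
  assumes "C \<in> obj X" "B \<in> obj X" "g \<in> arr X" "h \<in> arr X" "src X g = A" "src X h = A"
    "tgt X g = \<lbrakk>C \<Rightarrow> B\<rbrakk>" "tgt X h = \<lbrakk>C \<Rightarrow> B\<rbrakk>"
    "\<langle>\<pi>\<^sub>0 C A, \<pi>\<^sub>1 C A \<cdot> g\<rangle> \<cdot> \<epsilon> C B = \<langle>\<pi>\<^sub>0 C A, \<pi>\<^sub>1 C A \<cdot> h\<rangle> \<cdot> \<epsilon> C B"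
  shows "g = h"
proof -
  have A: "A \<in> obj X" using assms(3,5) by auto
  show ?thesis
    using curry_eqI[OF assms(1) A assms(2,3,5,7) refl]
      curry_eqI[OF assms(1) A assms(2,4,6,8) refl] assms(9) by metis
qed

lemma curry_uncurry [simp]:
  assumes "C \<in> obj X" "B \<in> obj X" "g \<in> arr X" "src X g = A" "tgt X g = \<lbrakk>C \<Rightarrow> B\<rbrakk>"
  shows "\<Lambda> C A (\<langle>\<pi>\<^sub>0 C A, \<pi>\<^sub>1 C A \<cdot> g\<rangle> \<cdot> \<epsilon> C B) = g"
  using curry_eqI[of C A B g] assms by auto

lemma curry_of_ev [simp]:
  assumes "C \<in> obj X" "B \<in> obj X"
  shows "\<Lambda> C \<lbrakk>C \<Rightarrow> B\<rbrakk> (\<epsilon> C B) = \<one> \<lbrakk>C \<Rightarrow> B\<rbrakk>"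
  using curry_eqI[of C "\<lbrakk>C \<Rightarrow> B\<rbrakk>" B "\<one> \<lbrakk>C \<Rightarrow> B\<rbrakk>" "\<epsilon> C B"] assms by simp

text \<open>
  Evaluation is additive in the function argument because currying preserves sums.
\<close>

lemma ev_add [simp]:
  assumes "C \<in> obj X" "B \<in> obj X" "x \<in> arr X" "u \<in> arr X" "v \<in> arr X" "tgt X x = C"
    "src X x = src X u" "src X u = src X v" "tgt X u = \<lbrakk>C \<Rightarrow> B\<rbrakk>" "tgt X v = \<lbrakk>C \<Rightarrow> B\<rbrakk>"
  shows "\<langle>x, u \<oplus> v\<rangle> \<cdot> \<epsilon> C B = \<langle>x, u\<rangle> \<cdot> \<epsilon> C B \<oplus> \<langle>x, v\<rangle> \<cdot> \<epsilon> C B"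
proof -
  let ?Z = "src X v"
  let ?u = "\<langle>\<pi>\<^sub>0 C ?Z, \<pi>\<^sub>1 C ?Z \<cdot> u\<rangle> \<cdot> \<epsilon> C B" and ?v = "\<langle>\<pi>\<^sub>0 C ?Z, \<pi>\<^sub>1 C ?Z \<cdot> v\<rangle> \<cdot> \<epsilon> C B"
  have "\<Lambda> C ?Z (?u \<oplus> ?v) = u \<oplus> v"
    using assms curry_add[of C ?Z ?u B ?v] by (simp add: hom_iff)
  then have "\<langle>x, u \<oplus> v\<rangle> \<cdot> \<epsilon> C B = \<langle>x, \<Lambda> C ?Z (?u \<oplus> ?v)\<rangle> \<cdot> \<epsilon> C B" by simp
  also have "\<dots> = \<langle>x, \<one> ?Z\<rangle> \<cdot> (?u \<oplus> ?v)"
    by (rule ev_curry) (use assms in simp_all)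
  finally show ?thesis using assms by simp
qed

lemma ev_zero [simp]:
  assumes "C \<in> obj X" "B \<in> obj X" "x \<in> arr X" "tgt X x = C" "src X x = Z"
  shows "\<langle>x, \<zero> Z \<lbrakk>C \<Rightarrow> B\<rbrakk>\<rangle> \<cdot> \<epsilon> C B = \<zero> Z B"
proof -
  have Z: "Z \<in> obj X" using assms by auto
  have "\<langle>x, \<Lambda> C Z (\<zero> (C \<otimes> Z) B)\<rangle> \<cdot> \<epsilon> C B = \<langle>x, \<one> Z\<rangle> \<cdot> \<zero> (C \<otimes> Z) B"
    by (rule ev_curry) (use assms Z in simp_all)
  then show ?thesis using assms Z curry_zero[of C Z B] by simp
qed

lemma ihom_map_typing [simp]:
  assumes "f \<in> arr X" "g \<in> arr X"
  shows "ihom_map X f g \<in> arr X" "src X (ihom_map X f g) = \<lbrakk>tgt X f \<Rightarrow> src X g\<rbrakk>"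
    "tgt X (ihom_map X f g) = \<lbrakk>src X f \<Rightarrow> tgt X g\<rbrakk>"
  using assms by (simp_all add: ihom_map_def Let_def prod_map_eq)

lemma eta_typing [simp]:
  assumes "C \<in> obj X" "A \<in> obj X"
  shows "eta X C A \<in> arr X" "src X (eta X C A) = A" "tgt X (eta X C A) = \<lbrakk>C \<Rightarrow> A\<rbrakk>"
  using assms by (simp_all add: eta_def)

lemma mu_typing [simp]:
  assumes "C \<in> obj X" "A \<in> obj X"
  shows "mu X C A \<in> arr X" "src X (mu X C A) = \<lbrakk>C \<Rightarrow> \<lbrakk>C \<Rightarrow> A\<rbrakk>\<rbrakk>" "tgt X (mu X C A) = \<lbrakk>C \<Rightarrow> A\<rbrakk>"
  using assms by (simp_all add: mu_def)

lemma ev_ihom_map [simp]: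
  assumes "f \<in> arr X" "g \<in> arr X" "src X f = C" "tgt X g = B" "x \<in> arr X" "y \<in> arr X"
    "src X x = src X y" "tgt X x = C" "tgt X y = \<lbrakk>tgt X f \<Rightarrow> src X g\<rbrakk>"
  shows "\<langle>x, y \<cdot> ihom_map X f g\<rangle> \<cdot> \<epsilon> C B = \<langle>x \<cdot> f, y\<rangle> \<cdot> \<epsilon> (tgt X f) (src X g) \<cdot> g"
  using assms by (auto simp: ihom_map_def Let_def prod_map_eq)

lemma ev_eta [simp]:
  assumes "C \<in> obj X" "A \<in> obj X" "x \<in> arr X" "y \<in> arr X" "src X x = src X y" "tgt X x = C" "tgt X y = A"
  shows "\<langle>x, y \<cdot> eta X C A\<rangle> \<cdot> \<epsilon> C A = y"
  using assms by (simp add: eta_def)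

text \<open>
  On elements \<open>\<mu>\<close> sends \<open>\<phi>\<close> to \<open>c \<mapsto> \<phi>(c)(c)\<close>, the diagonal of a function of two arguments.
\<close>

lemma ev_mu [simp]:
  assumes "C \<in> obj X" "A \<in> obj X" "x \<in> arr X" "y \<in> arr X" "src X x = src X y" "tgt X x = C"
    "tgt X y = \<lbrakk>C \<Rightarrow> \<lbrakk>C \<Rightarrow> A\<rbrakk>\<rbrakk>"
  shows "\<langle>x, y \<cdot> mu X C A\<rangle> \<cdot> \<epsilon> C A = \<langle>x, \<langle>x, y\<rangle> \<cdot> \<epsilon> C \<lbrakk>C \<Rightarrow> A\<rbrakk>\<rangle> \<cdot> \<epsilon> C A"
  using assms by (simp add: mu_def)

lemma compose_curry:
  assumes "C \<in> obj X" "A \<in> obj X" "f \<in> arr X" "src X f = C \<otimes> A" "x \<in> arr X" "tgt X x = A"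
    "src X x = Z"
  shows "x \<cdot> \<Lambda> C A f = \<Lambda> C Z (\<langle>\<pi>\<^sub>0 C Z, \<pi>\<^sub>1 C Z \<cdot> x\<rangle> \<cdot> f)"
  by (rule curry_eqI[where B="tgt X f"]) (use assms in auto)

end

section \<open>Differential combinators\<close>

context differential_combinator
begin

lemma D_typing [simp]:
  assumes "f \<in> arr X"
  shows "D f \<in> arr X" "src X (D f) = src X f \<otimes> src X f" "tgt X (D f) = tgt X f"
  using D_hom[of f "src X f" "tgt X f"] assms by (auto simp: hom_iff)

lemma D_rules [simp]:
  "\<lbrakk>f \<in> arr X; g \<in> arr X; src X f = src X g; tgt X f = tgt X g\<rbrakk> \<Longrightarrow> D (f \<oplus> g) = D f \<oplus> D g"
  "\<lbrakk>A \<in> obj X; B \<in> obj X\<rbrakk> \<Longrightarrow> D (\<zero> A B) = \<zero> (A \<otimes> A) B"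
  "A \<in> obj X \<Longrightarrow> D (\<one> A) = \<pi>\<^sub>1 A A"
  "\<lbrakk>A \<in> obj X; B \<in> obj X\<rbrakk> \<Longrightarrow> D (\<pi>\<^sub>0 A B) = \<pi>\<^sub>1 (A \<otimes> B) (A \<otimes> B) \<cdot> \<pi>\<^sub>0 A B"
  "\<lbrakk>A \<in> obj X; B \<in> obj X\<rbrakk> \<Longrightarrow> D (\<pi>\<^sub>1 A B) = \<pi>\<^sub>1 (A \<otimes> B) (A \<otimes> B) \<cdot> \<pi>\<^sub>1 A B"
  "\<lbrakk>f \<in> arr X; g \<in> arr X; src X f = src X g\<rbrakk> \<Longrightarrow> D \<langle>f, g\<rangle> = \<langle>D f, D g\<rangle>"
  "\<lbrakk>f \<in> arr X; g \<in> arr X; tgt X f = src X g\<rbrakk>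
    \<Longrightarrow> D (f \<cdot> g) = \<langle>\<pi>\<^sub>0 (src X f) (src X f) \<cdot> f, D f\<rangle> \<cdot> D g"
  using CD1_add[of f "src X f" "tgt X f" g] CD1_zero CD3_ident CD3_proj0 CD3_proj1
    CD4[of f "src X f" "tgt X f" g "tgt X g"] CD5[of f "src X f" "tgt X f" g "tgt X g"]
  by (auto simp: hom_iff)

lemma D_at_add [simp]:
  assumes "f \<in> arr X" "x \<in> arr X" "u \<in> arr X" "v \<in> arr X" "src X x = src X u" "src X u = src X v"
    "tgt X x = src X f" "tgt X u = src X f" "tgt X v = src X f"
  shows "\<langle>x, u \<oplus> v\<rangle> \<cdot> D f = \<langle>x, u\<rangle> \<cdot> D f \<oplus> \<langle>x, v\<rangle> \<cdot> D f"
proof -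
  let ?A = "src X f"
  have "\<langle>x, \<langle>u, v\<rangle>\<rangle> \<cdot> (prod_map X (\<one> ?A) (sum_map X ?A) \<cdot> D f) =
      \<langle>x, \<langle>u, v\<rangle>\<rangle> \<cdot> (prod_map X (\<one> ?A) (\<pi>\<^sub>0 ?A ?A) \<cdot> D f \<oplus> prod_map X (\<one> ?A) (\<pi>\<^sub>1 ?A ?A) \<cdot> D f)"
    using CD2_add[of f ?A "tgt X f"] assms by (simp add: hom_iff)
  then show ?thesis using assms by (simp add: prod_map_eq sum_map_def)
qed

lemma D_at_zero [simp]:
  assumes "f \<in> arr X" "x \<in> arr X" "tgt X x = A" "src X f = A" "src X x = Z"
  shows "\<langle>x, \<zero> Z A\<rangle> \<cdot> D f = \<zero> Z (tgt X f)"
proof -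
  have "x \<cdot> (\<langle>\<one> A, \<zero> A A\<rangle> \<cdot> D f) = \<zero> Z (tgt X f)"
    using CD2_zero[of f A "tgt X f"] assms by (auto simp: hom_iff)
  then show ?thesis using assms by auto
qed

lemma D_zero_at_zero [simp]:
  assumes "f \<in> arr X" "src X f = A" "Z \<in> obj X"
  shows "\<zero> Z (A \<otimes> A) \<cdot> D f = \<zero> Z (tgt X f)"
proof -
  have A: "A \<in> obj X" using assms by auto
  have "\<langle>\<zero> Z A, \<zero> Z A\<rangle> \<cdot> D f = \<zero> Z (tgt X f)"
    by (rule D_at_zero) (use assms A in simp_all)
  then show ?thesis using assms A by simp
qed

lemma DD_ell [simp]:
  assumes "f \<in> arr X" "x \<in> arr X" "v \<in> arr X" "src X x = src X v" "src X f = A" "src X x = Z"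
    "tgt X x = A" "tgt X v = A"
  shows "\<langle>\<langle>x, \<zero> Z A\<rangle>, \<langle>\<zero> Z A, v\<rangle>\<rangle> \<cdot> D (D f) = \<langle>x, v\<rangle> \<cdot> D f"
proof -
  have "\<langle>x, v\<rangle> \<cdot> (ell X A A A A \<cdot> D (D f)) = \<langle>x, v\<rangle> \<cdot> D f"
    using CD6[of f A "tgt X f"] assms by (auto simp: hom_iff)
  then show ?thesis using assms by (auto simp: ell_def prod_map_eq)
qed

text \<open>
  The case \<open>x = 0\<close> needs its own rule, since \<open>\<langle>0, 0\<rangle>\<close> is contracted to \<open>0\<close> before the
  general pattern can match.
\<close>

lemma DD_ell_at_zero [simp]:
  assumes "f \<in> arr X" "v \<in> arr X" "src X f = A" "src X v = Z" "tgt X v = A"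
  shows "\<langle>\<zero> Z (A \<otimes> A), \<langle>\<zero> Z A, v\<rangle>\<rangle> \<cdot> D (D f) = \<langle>\<zero> Z A, v\<rangle> \<cdot> D f"
proof -
  have A: "A \<in> obj X" and Z: "Z \<in> obj X" using assms by auto
  have "\<langle>\<langle>\<zero> Z A, \<zero> Z A\<rangle>, \<langle>\<zero> Z A, v\<rangle>\<rangle> \<cdot> D (D f) = \<langle>\<zero> Z A, v\<rangle> \<cdot> D f"
    by (rule DD_ell) (use assms A Z in simp_all)
  then show ?thesis using assms A Z by simp
qed

lemma DD_interchange:
  assumes "f \<in> arr X" "a \<in> arr X" "b \<in> arr X" "c \<in> arr X" "d \<in> arr X"
    "src X a = Z" "src X b = Z" "src X c = Z" "src X d = Z" "src X f = A"
    "tgt X a = A" "tgt X b = A" "tgt X c = A" "tgt X d = A"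
  shows "\<langle>\<langle>a, b\<rangle>, \<langle>c, d\<rangle>\<rangle> \<cdot> D (D f) = \<langle>\<langle>a, c\<rangle>, \<langle>b, d\<rangle>\<rangle> \<cdot> D (D f)"
proof -
  have "\<langle>\<langle>a, b\<rangle>, \<langle>c, d\<rangle>\<rangle> \<cdot> (interchange X A A A A \<cdot> D (D f)) = \<langle>\<langle>a, b\<rangle>, \<langle>c, d\<rangle>\<rangle> \<cdot> D (D f)"
    using CD7[of f A "tgt X f"] assms by (auto simp: hom_iff)
  then show ?thesis using assms by (auto simp: interchange_def prod_map_eq)
qed

lemma lin_of_diff_eq:
  "\<lbrakk>f \<in> arr X; src X f = A\<rbrakk> \<Longrightarrow> lin_of_diff X D f = \<langle>\<zero> A A, \<one> A\<rangle> \<cdot> D f"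
  by (simp add: lin_of_diff_def)

lemma partial_derivative_eq:
  "\<lbrakk>C \<in> obj X; A \<in> obj X\<rbrakk> \<Longrightarrow> partial_derivative X D C A f =
     \<langle>\<langle>\<pi>\<^sub>0 C (A \<otimes> A), \<pi>\<^sub>1 C (A \<otimes> A) \<cdot> \<pi>\<^sub>0 A A\<rangle>,
      \<langle>\<zero> (C \<otimes> (A \<otimes> A)) C, \<pi>\<^sub>1 C (A \<otimes> A) \<cdot> \<pi>\<^sub>1 A A\<rangle>\<rangle> \<cdot> D f"
  by (simp add: partial_derivative_def prod_map_eq)

text \<open>
  Additivity of \<open>L[f]\<close> is additivity of \<open>D[f]\<close> in the direction, and [L.5] is the chain rule at \<open>0\<close>:
  both sides equal \<open>D[g](f(0), D[f](0, v))\<close>. Idempotence is [CD.6], as \<open>D[D[f]]((0,0),(0,v)) = D[f](0,v)\<close>.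
\<close>

lemma linearizing_combinator_lin_of_diff: "linearizing_combinator X (lin_of_diff X D)"
proof unfold_locales
  fix f assume "f \<in> arr X"
  then show "additive X (lin_of_diff X D f)"
    by (auto simp: additive_def hom_iff lin_of_diff_eq)
next
  fix f assume "f \<notin> arr X"
  then show "lin_of_diff X D f = undefined" by (simp add: lin_of_diff_def)
qed (auto simp: hom_iff lin_of_diff_eq)

end

context cartesian_closed_left_additive_category
begin

text \<open>
  From left to right, apply [CD.\<lambda>] to \<open>\<epsilon> = \<lambda>\<^sup>-\<^sup>1(1)\<close>. Conversely, write \<open>f(c,a) = \<epsilon>(c, \<lambda>(f)(a))\<close>; the
  chain rule then expresses the partial derivative of \<open>f\<close> in \<open>a\<close> by that of \<open>\<epsilon>\<close> in its second
  argument.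
\<close>

lemma CD_lambda_iff_CD_ev:
  assumes "differential_combinator X D"
  shows "CD_lambda X D \<longleftrightarrow> CD_ev X D"
proof
  interpret differential_combinator X D by fact
  assume lam: "CD_lambda X D"
  show "CD_ev X D"
    unfolding CD_ev_def
  proof (intro ballI)
    fix A C assume AC: "A \<in> obj X" "C \<in> obj X"
    let ?E = "\<lbrakk>C \<Rightarrow> A\<rbrakk>"
    have "D (\<Lambda> C ?E (\<epsilon> C A)) = \<Lambda> C (?E \<otimes> ?E) (partial_derivative X D C ?E (\<epsilon> C A))"
      using lam AC ev_hom[of C A] unfolding CD_lambda_def by (meson ihom_obj)
    then have "\<pi>\<^sub>1 ?E ?E = \<Lambda> C (?E \<otimes> ?E) (partial_derivative X D C ?E (\<epsilon> C A))"
      using AC by simp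
    then have "\<langle>\<pi>\<^sub>0 C (?E \<otimes> ?E), \<pi>\<^sub>1 C (?E \<otimes> ?E) \<cdot> \<pi>\<^sub>1 ?E ?E\<rangle> \<cdot> \<epsilon> C A =
        \<langle>\<pi>\<^sub>0 C (?E \<otimes> ?E), \<pi>\<^sub>1 C (?E \<otimes> ?E) \<cdot> \<Lambda> C (?E \<otimes> ?E) (partial_derivative X D C ?E (\<epsilon> C A))\<rangle>
          \<cdot> \<epsilon> C A"
      by simp
    then show "partial_derivative X D C ?E (\<epsilon> C A) = prod_map X (\<one> C) (\<pi>\<^sub>1 ?E ?E) \<cdot> \<epsilon> C A"
      using AC by (simp add: partial_derivative_eq prod_map_eq)
  qed
next
  interpret differential_combinator X D by fact
  assume ev: "CD_ev X D"
  show "CD_lambda X D"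
    unfolding CD_lambda_def
  proof (intro ballI)
    fix A B C f assume "A \<in> obj X" "B \<in> obj X" "C \<in> obj X" "f \<in> hom X (C \<otimes> A) B"
    then have f: "A \<in> obj X" "B \<in> obj X" "C \<in> obj X" "f \<in> arr X" "src X f = C \<otimes> A" "tgt X f = B"
      by (auto simp: hom_iff)
    let ?E = "\<lbrakk>C \<Rightarrow> B\<rbrakk>" and ?P = "C \<otimes> (A \<otimes> A)"
    let ?a = "\<pi>\<^sub>1 C (A \<otimes> A) \<cdot> \<pi>\<^sub>0 A A" and ?v = "\<pi>\<^sub>1 C (A \<otimes> A) \<cdot> \<pi>\<^sub>1 A A"
    have Dev: "\<langle>\<langle>\<pi>\<^sub>0 C (?E \<otimes> ?E), \<pi>\<^sub>1 C (?E \<otimes> ?E) \<cdot> \<pi>\<^sub>0 ?E ?E\<rangle>,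
        \<langle>\<zero> (C \<otimes> (?E \<otimes> ?E)) C, \<pi>\<^sub>1 C (?E \<otimes> ?E) \<cdot> \<pi>\<^sub>1 ?E ?E\<rangle>\<rangle> \<cdot> D (\<epsilon> C B)
        = \<langle>\<pi>\<^sub>0 C (?E \<otimes> ?E), \<pi>\<^sub>1 C (?E \<otimes> ?E) \<cdot> \<pi>\<^sub>1 ?E ?E\<rangle> \<cdot> \<epsilon> C B"
      using ev f unfolding CD_ev_def by (auto simp: partial_derivative_eq prod_map_eq)
    \<comment> \<open>[CD.ev] at the element \<open>(c, (\<lambda>(f)(a), D[\<lambda>(f)](a,v)))\<close>\<close>
    let ?z = "\<langle>\<pi>\<^sub>0 C (A \<otimes> A), \<langle>?a \<cdot> \<Lambda> C A f, \<langle>?a, ?v\<rangle> \<cdot> D (\<Lambda> C A f)\<rangle>\<rangle>"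
    have eq: "\<langle>\<langle>\<pi>\<^sub>0 C (A \<otimes> A), ?a \<cdot> \<Lambda> C A f\<rangle>, \<langle>\<zero> ?P C, \<langle>?a, ?v\<rangle> \<cdot> D (\<Lambda> C A f)\<rangle>\<rangle> \<cdot> D (\<epsilon> C B) =
        \<langle>\<pi>\<^sub>0 C (A \<otimes> A), \<langle>?a, ?v\<rangle> \<cdot> D (\<Lambda> C A f)\<rangle> \<cdot> \<epsilon> C B"
      using arg_cong[OF Dev, of "\<lambda>k. ?z \<cdot> k"] f by simp
    have "f = \<langle>\<pi>\<^sub>0 C A, \<pi>\<^sub>1 C A \<cdot> \<Lambda> C A f\<rangle> \<cdot> \<epsilon> C B" using f by simp
    then have "D f = D (\<langle>\<pi>\<^sub>0 C A, \<pi>\<^sub>1 C A \<cdot> \<Lambda> C A f\<rangle> \<cdot> \<epsilon> C B)" by simp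
    also have "\<dots> = \<langle>\<pi>\<^sub>0 (C \<otimes> A) (C \<otimes> A) \<cdot> \<langle>\<pi>\<^sub>0 C A, \<pi>\<^sub>1 C A \<cdot> \<Lambda> C A f\<rangle>,
        D \<langle>\<pi>\<^sub>0 C A, \<pi>\<^sub>1 C A \<cdot> \<Lambda> C A f\<rangle>\<rangle> \<cdot> D (\<epsilon> C B)"
      using f by (subst D_rules(7)) (simp_all del: ev_curry)
    finally have Df: "D f = \<dots>" .
    have "partial_derivative X D C A f = \<langle>\<pi>\<^sub>0 C (A \<otimes> A), \<langle>?a, ?v\<rangle> \<cdot> D (\<Lambda> C A f)\<rangle> \<cdot> \<epsilon> C B"
      unfolding partial_derivative_eq[OF f(3,1)] Df using eq f by simp
    then show "D (\<Lambda> C A f) = \<Lambda> C (A \<otimes> A) (partial_derivative X D C A f)"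
      using f by simp
  qed
qed

end

section \<open>From closed differential combinators to exponentiable linearizing combinators\<close>

context cartesian_closed_differential_category
begin

lemma CD_ev: "CD_ev X D"
  using CD_lambda CD_lambda_iff_CD_ev[OF differential_combinator_axioms] by simp

lemma D_ev [simp]:
  assumes "C \<in> obj X" "B \<in> obj X" "x \<in> arr X" "y \<in> arr X" "w \<in> arr X" "src X x = Z"
    "src X y = Z" "src X w = Z" "tgt X x = C" "tgt X y = \<lbrakk>C \<Rightarrow> B\<rbrakk>" "tgt X w = \<lbrakk>C \<Rightarrow> B\<rbrakk>"
  shows "\<langle>\<langle>x, y\<rangle>, \<langle>\<zero> Z C, w\<rangle>\<rangle> \<cdot> D (\<epsilon> C B) = \<langle>x, w\<rangle> \<cdot> \<epsilon> C B"
proof -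
  let ?E = "\<lbrakk>C \<Rightarrow> B\<rbrakk>"
  have "\<langle>x, \<langle>y, w\<rangle>\<rangle> \<cdot> partial_derivative X D C ?E (\<epsilon> C B) =
      \<langle>x, \<langle>y, w\<rangle>\<rangle> \<cdot> (prod_map X (\<one> C) (\<pi>\<^sub>1 ?E ?E) \<cdot> \<epsilon> C B)"
    using CD_ev assms(1,2) by (simp add: CD_ev_def)
  then show ?thesis using assms by (simp add: partial_derivative_eq prod_map_eq)
qed

lemma D_curry [simp]:
  assumes "C \<in> obj X" "A \<in> obj X" "f \<in> arr X" "src X f = C \<otimes> A"
  shows "D (\<Lambda> C A f) = \<Lambda> C (A \<otimes> A) (partial_derivative X D C A f)"
proof -
  have "f \<in> hom X (C \<otimes> A) (tgt X f)" "tgt X f \<in> obj X" using assms by (auto simp: hom_iff)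
  then show ?thesis using CD_lambda assms(1,2) unfolding CD_lambda_def by blast
qed

text \<open>
  At \<open>a = 0\<close>, [CD.\<lambda>] says that linearizing a curried map is differentiating at \<open>0\<close> in the second
  argument only. All of [EL.1] to [EL.3] is checked through this formula.
\<close>

lemma lin_of_diff_curry:
  assumes "C \<in> obj X" "A \<in> obj X" "f \<in> arr X" "src X f = C \<otimes> A"
  shows "lin_of_diff X D (\<Lambda> C A f) = \<Lambda> C A (ell X C A C A \<cdot> D f)"
  using assms
  by (simp add: lin_of_diff_eq partial_derivative_eq ell_def prod_map_eq compose_curry)

lemma L_part1_lin_of_diff:
  assumes "f \<in> arr X" "src X f = A \<otimes> B" "A \<in> obj X" "B \<in> obj X"
  shows "L_part1 X (lin_of_diff X D) A B f =
    \<langle>\<langle>\<pi>\<^sub>0 A B, \<zero> (A \<otimes> B) B\<rangle>, \<langle>\<zero> (A \<otimes> B) A, \<pi>\<^sub>1 A B\<rangle>\<rangle> \<cdot> D f"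
  using assms by (simp add: L_part1_def lin_of_diff_curry uncurry_eq ell_def prod_map_eq)

lemma L_part0_lin_of_diff:
  assumes "f \<in> arr X" "src X f = A \<otimes> B" "A \<in> obj X" "B \<in> obj X"
  shows "L_part0 X (lin_of_diff X D) A B f =
    \<langle>\<langle>\<zero> (A \<otimes> B) A, \<pi>\<^sub>1 A B\<rangle>, \<langle>\<pi>\<^sub>0 A B, \<zero> (A \<otimes> B) B\<rangle>\<rangle> \<cdot> D f"
  using assms
  by (simp add: L_part0_def lin_of_diff_curry uncurry_eq ell_def prod_map_eq swap_def)

text \<open>
  The two partial linearizations are \<open>D[D[f]]\<close> at the zero base point with the two increments in
  either order, so [EL.3] is an instance of [CD.7].
\<close>

lemma exponentiable_lin_of_diff: "exponentiable_linearizing_combinator X (lin_of_diff X D)"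
proof -
  interpret L: linearizing_combinator X "lin_of_diff X D"
    by (rule linearizing_combinator_lin_of_diff)
  show ?thesis
  proof unfold_locales
    fix C A assume "C \<in> obj X" "A \<in> obj X"
    then show "lin_of_diff X D (eta X C A) = eta X C A" "lin_of_diff X D (mu X C A) = mu X C A"
      by (simp_all add: eta_def mu_def lin_of_diff_curry ell_def prod_map_eq)
  next
    fix f g assume fg: "f \<in> arr X" "g \<in> arr X"
    then have "lin_of_diff X D g = \<langle>\<zero> (src X g) (src X g), \<one> (src X g)\<rangle> \<cdot> D g"
      by (simp add: lin_of_diff_eq)
    with fg show "lin_of_diff X D (ihom_map X f g) = ihom_map X f (lin_of_diff X D g)"
      by (simp add: ihom_map_def Let_def lin_of_diff_curry ell_def prod_map_eq)
  next
    fix A B f C assume "A \<in> obj X" "B \<in> obj X" "f \<in> hom X (A \<otimes> B) C"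
    \<comment> \<open>Fixing \<open>c\<close> orients [CD.7], which would otherwise rewrite back and forth.\<close>
    then show "L_part0 X (lin_of_diff X D) A B (L_part1 X (lin_of_diff X D) A B f) =
        L_part1 X (lin_of_diff X D) A B (L_part0 X (lin_of_diff X D) A B f)"
      by (simp add: hom_iff L_part0_lin_of_diff L_part1_lin_of_diff
          DD_interchange[where c="\<langle>\<pi>\<^sub>0 A B, \<zero> (A \<otimes> B) B\<rangle>"])
  qed
qed

end

section \<open>Linearization in a context\<close>

text \<open>
  The part of the theory of linearization in context that holds on both sides of the passage between
  exponentiable combinators and closed systems. It is instantiated once with \<open>\<lambda>\<^sup>-\<^sup>1(L[\<lambda>(-)])\<close>, in order
  to derive [L.7], and once with a given closed system, in order to derive [CD.\<lambda>].
\<close>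

locale contextual_linearization = cartesian_closed_left_additive_category X
  for X :: "('o, 'm, 'z) cartesian_closed_left_additive_category_scheme" (structure) +
  fixes M :: "'o \<Rightarrow> 'o \<Rightarrow> 'm \<Rightarrow> 'm"
  assumes M_typing [simp]:
      "\<lbrakk>C \<in> obj X; A \<in> obj X; f \<in> arr X; src X f = C \<otimes> A\<rbrakk> \<Longrightarrow> M C A f \<in> arr X"
      "\<lbrakk>C \<in> obj X; A \<in> obj X; f \<in> arr X; src X f = C \<otimes> A\<rbrakk> \<Longrightarrow> src X (M C A f) = C \<otimes> A"
      "\<lbrakk>C \<in> obj X; A \<in> obj X; f \<in> arr X; src X f = C \<otimes> A\<rbrakk> \<Longrightarrow> tgt X (M C A f) = tgt X f"
    and M_add:
      "\<lbrakk>C \<in> obj X; A \<in> obj X; f \<in> arr X; g \<in> arr X; src X f = C \<otimes> A; src X g = C \<otimes> A;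
        tgt X f = tgt X g\<rbrakk> \<Longrightarrow> M C A (f \<oplus> g) = M C A f \<oplus> M C A g"
    and M_zero:
      "\<lbrakk>C \<in> obj X; A \<in> obj X; B \<in> obj X\<rbrakk> \<Longrightarrow> M C A (\<zero> (C \<otimes> A) B) = \<zero> (C \<otimes> A) B"
    and M_at_zero:
      "\<lbrakk>C \<in> obj X; A \<in> obj X; f \<in> arr X; src X f = C \<otimes> A\<rbrakk>
        \<Longrightarrow> \<langle>\<pi>\<^sub>0 C A, \<zero> (C \<otimes> A) A\<rangle> \<cdot> M C A f = \<zero> (C \<otimes> A) (tgt X f)"
    and M_chain:
      "\<lbrakk>C \<in> obj X; A \<in> obj X; B \<in> obj X; f \<in> arr X; g \<in> arr X; src X f = C \<otimes> A; tgt X f = B;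
        src X g = C \<otimes> B\<rbrakk>
        \<Longrightarrow> M C A (\<langle>\<pi>\<^sub>0 C A, f\<rangle> \<cdot> g) =
          \<langle>\<pi>\<^sub>0 C A, M C A f\<rangle> \<cdot>
            M C B (\<langle>\<pi>\<^sub>0 C B, \<pi>\<^sub>1 C B \<oplus> \<langle>\<pi>\<^sub>0 C B, \<zero> (C \<otimes> B) A\<rangle> \<cdot> f\<rangle> \<cdot> g)"
    and M_base_change:
      "\<lbrakk>C \<in> obj X; A \<in> obj X; h \<in> arr X; f \<in> arr X; src X h = C'; tgt X h = C; src X f = C \<otimes> A\<rbrakk>
        \<Longrightarrow> \<langle>\<pi>\<^sub>0 C' A \<cdot> h, \<pi>\<^sub>1 C' A\<rangle> \<cdot> M C A f = M C' A (\<langle>\<pi>\<^sub>0 C' A \<cdot> h, \<pi>\<^sub>1 C' A\<rangle> \<cdot> f)"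
    and M_ev:
      "\<lbrakk>C \<in> obj X; B \<in> obj X\<rbrakk> \<Longrightarrow> M C \<lbrakk>C \<Rightarrow> B\<rbrakk> (\<epsilon> C B) = \<epsilon> C B"
begin

text \<open>
  A map that ignores its second argument is unchanged by precomposition with \<open>\<langle>\<pi>\<^sub>0, 0\<rangle>\<close>; by the chain
  rule its linearization then factors through \<open>\<langle>\<pi>\<^sub>0, 0\<rangle>\<close> too, where linearizations vanish.
\<close>

lemma M_const:
  assumes "C \<in> obj X" "A \<in> obj X" "k \<in> arr X" "src X k = C"
  shows "M C A (\<pi>\<^sub>0 C A \<cdot> k) = \<zero> (C \<otimes> A) (tgt X k)"
proof -
  have "M C A (\<pi>\<^sub>0 C A \<cdot> k) = M C A (\<langle>\<pi>\<^sub>0 C A, \<zero> (C \<otimes> A) A\<rangle> \<cdot> (\<pi>\<^sub>0 C A \<cdot> k))"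
    using assms by simp
  also have "\<dots> = \<zero> (C \<otimes> A) (tgt X k)"
    by (subst M_chain[where B=A]) (use assms in \<open>simp_all add: M_zero M_at_zero\<close>)
  finally show ?thesis .
qed

lemma M_at_base_change:
  assumes "C \<in> obj X" "A \<in> obj X" "h \<in> arr X" "f \<in> arr X" "src X h = C'" "tgt X h = C"
    "src X f = C \<otimes> A" "x \<in> arr X" "a \<in> arr X" "src X x = src X a" "tgt X x = C'" "tgt X a = A"
  shows "\<langle>x \<cdot> h, a\<rangle> \<cdot> M C A f = \<langle>x, a\<rangle> \<cdot> M C' A (\<langle>\<pi>\<^sub>0 C' A \<cdot> h, \<pi>\<^sub>1 C' A\<rangle> \<cdot> f)"
proof -
  have "C' \<in> obj X" using assms by auto
  then have "\<langle>x \<cdot> h, a\<rangle> \<cdot> M C A f = \<langle>x, a\<rangle> \<cdot> (\<langle>\<pi>\<^sub>0 C' A \<cdot> h, \<pi>\<^sub>1 C' A\<rangle> \<cdot> M C A f)"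
    using assms by simp
  also have "\<dots> = \<langle>x, a\<rangle> \<cdot> M C' A (\<langle>\<pi>\<^sub>0 C' A \<cdot> h, \<pi>\<^sub>1 C' A\<rangle> \<cdot> f)"
    by (subst M_base_change) (use assms in simp_all)
  finally show ?thesis .
qed

text \<open>
  For \<open>h(c,(a,v)) = H(a,v)(c)\<close>, linearizing in \<open>v\<close> with context \<open>(c,a)\<close> may be done on \<open>H\<close> with context
  \<open>a\<close>. Apply the chain rule to \<open>h\<close> as \<open>H\<close> followed by evaluation at \<open>c\<close>. The shift by \<open>H(a,0)\<close> that [L.5] inserts
  contributes a constant because evaluation is additive, and evaluation is its own linearization.
\<close>

lemma M_of_ev_in_larger_context:
  assumes "C \<in> obj X" "A \<in> obj X" "V \<in> obj X" "B \<in> obj X" "H \<in> arr X" "src X H = A \<otimes> V"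
    "tgt X H = \<lbrakk>C \<Rightarrow> B\<rbrakk>"
  shows "M (C \<otimes> A) V (\<langle>\<pi>\<^sub>0 (C \<otimes> A) V \<cdot> \<pi>\<^sub>0 C A,
            \<langle>\<pi>\<^sub>0 (C \<otimes> A) V \<cdot> \<pi>\<^sub>1 C A, \<pi>\<^sub>1 (C \<otimes> A) V\<rangle> \<cdot> H\<rangle> \<cdot> \<epsilon> C B)
    = \<langle>\<pi>\<^sub>0 (C \<otimes> A) V \<cdot> \<pi>\<^sub>0 C A, \<langle>\<pi>\<^sub>0 (C \<otimes> A) V \<cdot> \<pi>\<^sub>1 C A, \<pi>\<^sub>1 (C \<otimes> A) V\<rangle> \<cdot> M A V H\<rangle> \<cdot> \<epsilon> C B"
    (is "M ?P V (\<langle>?c, ?a\<rangle> \<cdot> _) = _")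
proof -
  let ?E = "\<lbrakk>C \<Rightarrow> B\<rbrakk>"
  let ?F = "\<langle>\<pi>\<^sub>0 ?P V \<cdot> \<pi>\<^sub>1 C A, \<pi>\<^sub>1 ?P V\<rangle> \<cdot> H"
  let ?k = "\<langle>\<pi>\<^sub>0 ?P ?E \<cdot> \<pi>\<^sub>0 C A, \<pi>\<^sub>1 ?P ?E\<rangle> \<cdot> \<epsilon> C B"
  let ?const = "\<langle>\<pi>\<^sub>0 C A, \<langle>\<pi>\<^sub>1 C A, \<zero> ?P V\<rangle> \<cdot> H\<rangle> \<cdot> \<epsilon> C B"
  have "\<langle>\<pi>\<^sub>0 ?P ?E, \<pi>\<^sub>1 ?P ?E \<oplus> \<langle>\<pi>\<^sub>0 ?P ?E, \<zero> (?P \<otimes> ?E) V\<rangle> \<cdot> ?F\<rangle> \<cdot> ?k = ?k \<oplus> \<pi>\<^sub>0 ?P ?E \<cdot> ?const"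
    using assms by simp
  moreover have "M ?P ?E (?k \<oplus> \<pi>\<^sub>0 ?P ?E \<cdot> ?const) = ?k"
  proof -
    have "M ?P ?E (?k \<oplus> \<pi>\<^sub>0 ?P ?E \<cdot> ?const) = M ?P ?E ?k \<oplus> M ?P ?E (\<pi>\<^sub>0 ?P ?E \<cdot> ?const)"
      by (rule M_add) (use assms in simp_all)
    moreover have "M ?P ?E ?k = ?k"
      using M_base_change[of C ?E "\<pi>\<^sub>0 C A" "\<epsilon> C B" ?P] assms by (simp add: M_ev)
    moreover have "M ?P ?E (\<pi>\<^sub>0 ?P ?E \<cdot> ?const) = \<zero> (?P \<otimes> ?E) B"
      by (subst M_const) (use assms in simp_all)
    ultimately show ?thesis using assms by simp
  qed
  moreover have "M ?P V (\<langle>\<pi>\<^sub>0 ?P V, ?F\<rangle> \<cdot> ?k) = \<langle>\<pi>\<^sub>0 ?P V, M ?P V ?F\<rangle> \<cdot>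
      M ?P ?E (\<langle>\<pi>\<^sub>0 ?P ?E, \<pi>\<^sub>1 ?P ?E \<oplus> \<langle>\<pi>\<^sub>0 ?P ?E, \<zero> (?P \<otimes> ?E) V\<rangle> \<cdot> ?F\<rangle> \<cdot> ?k)"
    by (rule M_chain) (use assms in simp_all)
  ultimately have "M ?P V (\<langle>\<pi>\<^sub>0 ?P V, ?F\<rangle> \<cdot> ?k) = \<langle>\<pi>\<^sub>0 ?P V, M ?P V ?F\<rangle> \<cdot> ?k"
    by (simp only:)
  moreover have "M ?P V ?F = \<langle>\<pi>\<^sub>0 ?P V \<cdot> \<pi>\<^sub>1 C A, \<pi>\<^sub>1 ?P V\<rangle> \<cdot> M A V H"
    by (rule M_base_change[symmetric]) (use assms in simp_all)
  ultimately show ?thesis using assms by simp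
qed

text \<open>
  Partial linearizations in a context \<open>C\<close> are partial linearizations without context of the curried
  map, so that [L.7] reduces to a statement about maps \<open>A \<times> B \<rightarrow> [C,D]\<close>.
\<close>

lemma sys_part1_eq:
  assumes "C \<in> obj X" "A \<in> obj X" "B \<in> obj X" "f \<in> arr X" "src X f = C \<otimes> (A \<otimes> B)"
    "tgt X f = D"
  shows "sys_part1 X M C A B f = uncurry X C D (M A B (\<Lambda> C (A \<otimes> B) f))"
  using assms M_of_ev_in_larger_context[of C A B D "\<Lambda> C (A \<otimes> B) f"]
  by (auto simp: sys_part1_def assoc1_def assoc1_inv_def prod_map_eq uncurry_eq)

lemma sys_part0_eq:
  assumes "C \<in> obj X" "A \<in> obj X" "B \<in> obj X" "f \<in> arr X" "src X f = C \<otimes> (A \<otimes> B)"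
    "tgt X f = D"
  shows "sys_part0 X M C A B f =
    uncurry X C D (swap X A B \<cdot> M B A (swap X B A \<cdot> \<Lambda> C (A \<otimes> B) f))"
  using assms M_of_ev_in_larger_context[of C B A D "swap X B A \<cdot> \<Lambda> C (A \<otimes> B) f"]
  by (auto simp: sys_part0_def assoc0_def assoc0_inv_def prod_map_eq uncurry_eq swap_def)

end

context cartesian_closed_left_additive_category
begin

text \<open>
  This and the next two lemmas express operations in a context \<open>C\<close> as ordinary composites after
  currying; \<open>L\<close> can then be computed by its chain rule.
\<close>

lemma curry_compose:
  assumes "C \<in> obj X" "A \<in> obj X" "f \<in> arr X" "src X f = C \<otimes> A" "h \<in> arr X" "tgt X f = src X h"
  shows "\<Lambda> C A (f \<cdot> h) = \<Lambda> C A f \<cdot> ihom_map X (\<one> C) h"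
  by (rule ihom_ext[of C "tgt X h" _ _ A])
    (use assms in simp_all)

lemma curry_base_change:
  assumes "C \<in> obj X" "A \<in> obj X" "f \<in> arr X" "src X f = C \<otimes> A" "h \<in> arr X" "src X h = C'"
    "tgt X h = C"
  shows "\<Lambda> C' A (\<langle>\<pi>\<^sub>0 C' A \<cdot> h, \<pi>\<^sub>1 C' A\<rangle> \<cdot> f) = \<Lambda> C A f \<cdot> ihom_map X h (\<one> (tgt X f))"
  by (rule ihom_ext[of C' "tgt X f" _ _ A])
    (use assms in auto)

text \<open>
  On elements, the right-hand side sends \<open>a\<close> to \<open>c \<mapsto> g(c, f(c,a))\<close>: the functor \<open>[1,\<lambda>(g)]\<close> produces
  a function of two context variables, which \<open>\<mu>\<close> then identifies.
\<close>

lemma curry_compose_in_context: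
  assumes "C \<in> obj X" "A \<in> obj X" "B \<in> obj X" "f \<in> arr X" "src X f = C \<otimes> A" "tgt X f = B"
    "g \<in> arr X" "src X g = C \<otimes> B"
  shows "\<Lambda> C A (\<langle>\<pi>\<^sub>0 C A, f\<rangle> \<cdot> g) =
    \<Lambda> C A f \<cdot> ihom_map X (\<one> C) (\<Lambda> C B g) \<cdot> mu X C (tgt X g)"
  by (rule ihom_ext[of C "tgt X g" _ _ A])
    (use assms in simp_all)

end

section \<open>From exponentiable linearizing combinators to closed systems\<close>

context linearizing_combinator
begin

lemma L_typing [simp]:
  assumes "f \<in> arr X"
  shows "L f \<in> arr X" "src X (L f) = src X f" "tgt X (L f) = tgt X f"
  using L_hom[of f "src X f" "tgt X f"] assms by (auto simp: hom_iff)

lemma L_rules [simp]: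
  "\<lbrakk>f \<in> arr X; g \<in> arr X; src X f = src X g; tgt X f = tgt X g\<rbrakk> \<Longrightarrow> L (f \<oplus> g) = L f \<oplus> L g"
  "\<lbrakk>A \<in> obj X; B \<in> obj X\<rbrakk> \<Longrightarrow> L (\<zero> A B) = \<zero> A B"
  "A \<in> obj X \<Longrightarrow> L (\<one> A) = \<one> A"
  "\<lbrakk>A \<in> obj X; B \<in> obj X\<rbrakk> \<Longrightarrow> L (\<pi>\<^sub>0 A B) = \<pi>\<^sub>0 A B"
  "\<lbrakk>A \<in> obj X; B \<in> obj X\<rbrakk> \<Longrightarrow> L (\<pi>\<^sub>1 A B) = \<pi>\<^sub>1 A B"
  "\<lbrakk>f \<in> arr X; g \<in> arr X; src X f = src X g\<rbrakk> \<Longrightarrow> L \<langle>f, g\<rangle> = \<langle>L f, L g\<rangle>"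
  "f \<in> arr X \<Longrightarrow> L (L f) = L f"
  using L1_add[of f "src X f" "tgt X f" g] L1_zero L3_ident L3_proj0 L3_proj1
    L4[of f "src X f" "tgt X f" g "tgt X g"] L6
  by (auto simp: hom_iff)

lemma L_additive [simp]:
  "\<lbrakk>f \<in> arr X; x \<in> arr X; y \<in> arr X; src X x = src X y; tgt X x = src X f; tgt X y = src X f\<rbrakk>
    \<Longrightarrow> (x \<oplus> y) \<cdot> L f = x \<cdot> L f \<oplus> y \<cdot> L f"
  "\<lbrakk>f \<in> arr X; Z \<in> obj X; src X f = A\<rbrakk> \<Longrightarrow> \<zero> Z A \<cdot> L f = \<zero> Z (tgt X f)"
  using additiveD(2,3)[OF L2[of f]] by simp_all

lemma L_chain:
  "\<lbrakk>f \<in> arr X; g \<in> arr X; src X f = A; tgt X f = B; src X g = B\<rbrakk>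
    \<Longrightarrow> L (f \<cdot> g) = L f \<cdot> L ((\<one> B \<oplus> \<zero> B A \<cdot> f) \<cdot> g)"
  using L5[of f A B g "tgt X g"] by (auto simp: hom_iff)

lemma L_const:
  assumes "f \<in> arr X" "src X f = B" "A \<in> obj X"
  shows "L (\<zero> A B \<cdot> f) = \<zero> A (tgt X f)"
  using assms by (subst L_chain[where A=A and B=B]) auto

text \<open>
  A linear map \<open>h\<close>, that is \<open>L[h] = h\<close>, is additive by [L.2]. Hence the shift in [L.5] only adds the
  constant \<open>0f\<cdot>h\<close> to \<open>h\<close>, and linearization kills constants.
\<close>

lemma L_compose_linear:
  assumes "f \<in> arr X" "h \<in> arr X" "tgt X f = src X h" "L h = h"
  shows "L (f \<cdot> h) = L f \<cdot> h"
proof -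
  let ?A = "src X f" and ?B = "src X h"
  have add: "(\<one> ?B \<oplus> \<zero> ?B ?A \<cdot> f) \<cdot> h = h \<oplus> \<zero> ?B ?A \<cdot> (f \<cdot> h)"
    using L_additive(1)[of h "\<one> ?B" "\<zero> ?B ?A \<cdot> f"] assms by simp
  have "L (f \<cdot> h) = L f \<cdot> L ((\<one> ?B \<oplus> \<zero> ?B ?A \<cdot> f) \<cdot> h)"
    by (rule L_chain) (use assms in simp_all)
  also have "L ((\<one> ?B \<oplus> \<zero> ?B ?A \<cdot> f) \<cdot> h) = L h \<oplus> L (\<zero> ?B ?A \<cdot> (f \<cdot> h))"
    unfolding add by (rule L_rules) (use assms in simp_all)
  also have "L (\<zero> ?B ?A \<cdot> (f \<cdot> h)) = \<zero> ?B (tgt X h)"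
    by (subst L_const) (use assms in simp_all)
  finally show ?thesis using assms by simp
qed

end

context exponentiable_linearizing_combinator
begin

lemma L_ihom_map [simp]: "\<lbrakk>f \<in> arr X; g \<in> arr X\<rbrakk> \<Longrightarrow> L (ihom_map X f g) = ihom_map X f (L g)"
  by (rule EL2)

abbreviation M :: "'o \<Rightarrow> 'o \<Rightarrow> 'm \<Rightarrow> 'm" where
  "M \<equiv> sys_of_lin X L"

lemma M_eq:
  "\<lbrakk>C \<in> obj X; A \<in> obj X; f \<in> arr X; src X f = C \<otimes> A\<rbrakk>
    \<Longrightarrow> M C A f = \<langle>\<pi>\<^sub>0 C A, \<pi>\<^sub>1 C A \<cdot> L (\<Lambda> C A f)\<rangle> \<cdot> \<epsilon> C (tgt X f)"
  by (simp add: sys_of_lin_def uncurry_eq)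

lemma M_typing [simp]:
  assumes "C \<in> obj X" "A \<in> obj X" "f \<in> arr X" "src X f = C \<otimes> A"
  shows "M C A f \<in> arr X" "src X (M C A f) = C \<otimes> A" "tgt X (M C A f) = tgt X f"
  using assms by (simp_all add: M_eq)

lemma curry_M:
  assumes "C \<in> obj X" "A \<in> obj X" "f \<in> arr X" "src X f = C \<otimes> A"
  shows "\<Lambda> C A (M C A f) = L (\<Lambda> C A f)"
  using assms by (simp add: M_eq)

lemma M_eqI:
  assumes "C \<in> obj X" "A \<in> obj X" "f \<in> arr X" "src X f = C \<otimes> A" "k \<in> arr X" "src X k = C \<otimes> A"
    "tgt X f = tgt X k" "L (\<Lambda> C A f) = \<Lambda> C A k"
  shows "M C A f = k"
  using assms by (simp add: M_eq)

lemma M_at_add: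
  assumes "C \<in> obj X" "A \<in> obj X" "f \<in> arr X" "src X f = C \<otimes> A" "c \<in> arr X" "u \<in> arr X" "v \<in> arr X"
    "src X c = src X u" "src X u = src X v" "tgt X c = C" "tgt X u = A" "tgt X v = A"
  shows "\<langle>c, u \<oplus> v\<rangle> \<cdot> M C A f = \<langle>c, u\<rangle> \<cdot> M C A f \<oplus> \<langle>c, v\<rangle> \<cdot> M C A f"
  using assms by (simp add: M_eq)

lemma M_at_zero:
  assumes "C \<in> obj X" "A \<in> obj X" "f \<in> arr X" "src X f = C \<otimes> A" "c \<in> arr X" "src X c = Z" "tgt X c = C"
  shows "\<langle>c, \<zero> Z A\<rangle> \<cdot> M C A f = \<zero> Z (tgt X f)"
  using assms by (auto simp: M_eq)

lemma M_compose_linear: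
  assumes "C \<in> obj X" "A \<in> obj X" "f \<in> arr X" "src X f = C \<otimes> A" "h \<in> arr X" "tgt X f = src X h"
    "L h = h"
  shows "M C A (f \<cdot> h) = M C A f \<cdot> h"
proof (rule M_eqI)
  have "L (\<Lambda> C A (f \<cdot> h)) = L (\<Lambda> C A f) \<cdot> ihom_map X (\<one> C) h"
    by (subst curry_compose) (use assms L_compose_linear in simp_all)
  also have "\<dots> = \<Lambda> C A (M C A f \<cdot> h)"
    by (subst curry_compose) (use assms in \<open>simp_all add: curry_M\<close>)
  finally show "L (\<Lambda> C A (f \<cdot> h)) = \<Lambda> C A (M C A f \<cdot> h)" .
qed (use assms in simp_all)

text \<open>
  Reindexing the context along \<open>h\<close> becomes composition with \<open>[h,1]\<close> after currying, and \<open>[h,1]\<close> is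
  linear by [EL.2].
\<close>

lemma M_base_change:
  assumes "C \<in> obj X" "A \<in> obj X" "h \<in> arr X" "f \<in> arr X" "src X h = C'" "tgt X h = C"
    "src X f = C \<otimes> A"
  shows "\<langle>\<pi>\<^sub>0 C' A \<cdot> h, \<pi>\<^sub>1 C' A\<rangle> \<cdot> M C A f = M C' A (\<langle>\<pi>\<^sub>0 C' A \<cdot> h, \<pi>\<^sub>1 C' A\<rangle> \<cdot> f)"
proof (rule M_eqI[symmetric])
  have C': "C' \<in> obj X" using assms by auto
  have "L (\<Lambda> C' A (\<langle>\<pi>\<^sub>0 C' A \<cdot> h, \<pi>\<^sub>1 C' A\<rangle> \<cdot> f)) = L (\<Lambda> C A f) \<cdot> ihom_map X h (\<one> (tgt X f))"
    by (subst curry_base_change[where C=C]) (use assms C' L_compose_linear in simp_all)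
  also have "\<dots> = \<Lambda> C' A (\<langle>\<pi>\<^sub>0 C' A \<cdot> h, \<pi>\<^sub>1 C' A\<rangle> \<cdot> M C A f)"
    by (subst curry_base_change[where C=C]) (use assms C' in \<open>simp_all add: curry_M\<close>)
  finally show "L (\<Lambda> C' A (\<langle>\<pi>\<^sub>0 C' A \<cdot> h, \<pi>\<^sub>1 C' A\<rangle> \<cdot> f)) =
      \<Lambda> C' A (\<langle>\<pi>\<^sub>0 C' A \<cdot> h, \<pi>\<^sub>1 C' A\<rangle> \<cdot> M C A f)" .
qed (use assms in auto)

text \<open>
  With \<open>F = \<lambda>(f)\<close> and \<open>G = \<lambda>(g)\<close>, linearize the composite \<open>F [1,G] \<mu>\<close>. The shifted map \<open>(1 + 0F)[1,G]\<mu>\<close>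
  sends \<open>\<phi>\<close> to \<open>c \<mapsto> g(c, \<phi>(c) + f(c,0))\<close>; it is again of the form \<open>[1,G']\<mu>\<close>, with \<open>G'\<close> the curry of
  the shifted \<open>g\<close>, so that [EL.2] and linearity of \<open>\<mu>\<close> finish the computation.
\<close>

lemma M_chain:
  assumes "C \<in> obj X" "A \<in> obj X" "B \<in> obj X" "f \<in> arr X" "g \<in> arr X" "src X f = C \<otimes> A" "tgt X f = B"
    "src X g = C \<otimes> B"
  shows "M C A (\<langle>\<pi>\<^sub>0 C A, f\<rangle> \<cdot> g) = \<langle>\<pi>\<^sub>0 C A, M C A f\<rangle> \<cdot>
    M C B (\<langle>\<pi>\<^sub>0 C B, \<pi>\<^sub>1 C B \<oplus> \<langle>\<pi>\<^sub>0 C B, \<zero> (C \<otimes> B) A\<rangle> \<cdot> f\<rangle> \<cdot> g)"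
    (is "_ = _ \<cdot> M C B ?g'")
proof (rule M_eqI)
  let ?E = "\<lbrakk>C \<Rightarrow> B\<rbrakk>" and ?D = "tgt X g"
  let ?F = "\<Lambda> C A f" and ?G = "ihom_map X (\<one> C) (\<Lambda> C B g)" and ?G' = "ihom_map X (\<one> C) (\<Lambda> C B ?g')"
  have D: "?D \<in> obj X" using assms by simp
  \<comment> \<open>Both sides send \<open>\<phi>\<close> to \<open>c \<mapsto> g(c, \<phi>(c) + f(c,0))\<close>.\<close>
  have shift: "(\<one> ?E \<oplus> \<zero> ?E A \<cdot> ?F) \<cdot> (?G \<cdot> mu X C ?D) = ?G' \<cdot> mu X C ?D"
    by (rule ihom_ext[of C ?D _ _ ?E])
      (use assms D in simp_all)
  have "L (\<Lambda> C A (\<langle>\<pi>\<^sub>0 C A, f\<rangle> \<cdot> g)) = L (?F \<cdot> (?G \<cdot> mu X C ?D))"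
    using assms D by (simp add: curry_compose_in_context)
  also have "\<dots> = L ?F \<cdot> L ((\<one> ?E \<oplus> \<zero> ?E A \<cdot> ?F) \<cdot> (?G \<cdot> mu X C ?D))"
    by (rule L_chain) (use assms D in simp_all)
  also have "L ((\<one> ?E \<oplus> \<zero> ?E A \<cdot> ?F) \<cdot> (?G \<cdot> mu X C ?D)) = L ?G' \<cdot> mu X C ?D"
    unfolding shift by (rule L_compose_linear) (use assms D EL1_mu in simp_all)
  also have "L ?F \<cdot> (L ?G' \<cdot> mu X C ?D) =
      \<Lambda> C A (M C A f) \<cdot> ihom_map X (\<one> C) (\<Lambda> C B (M C B ?g')) \<cdot> mu X C ?D"
    using assms D by (simp add: curry_M)
  also have "\<dots> = \<Lambda> C A (\<langle>\<pi>\<^sub>0 C A, M C A f\<rangle> \<cdot> M C B ?g')"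
    by (subst curry_compose_in_context[where B=B]) (use assms D in simp_all)
  finally show "L (\<Lambda> C A (\<langle>\<pi>\<^sub>0 C A, f\<rangle> \<cdot> g)) = \<Lambda> C A (\<langle>\<pi>\<^sub>0 C A, M C A f\<rangle> \<cdot> M C B ?g')" .
qed (use assms in simp_all)

lemma curry_plus:
  assumes "C \<in> obj X" "A \<in> obj X" "f \<in> arr X" "g \<in> arr X" "src X f = C \<otimes> A" "src X g = C \<otimes> A"
    "tgt X f = tgt X g"
  shows "\<Lambda> C A (f \<oplus> g) = \<Lambda> C A f \<oplus> \<Lambda> C A g"
  using assms curry_add[of C A f "tgt X g" g] by (simp add: hom_iff)

lemma M_add:
  assumes "C \<in> obj X" "A \<in> obj X" "f \<in> arr X" "g \<in> arr X" "src X f = C \<otimes> A" "src X g = C \<otimes> A"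
    "tgt X f = tgt X g"
  shows "M C A (f \<oplus> g) = M C A f \<oplus> M C A g"
  by (rule M_eqI) (use assms in \<open>simp_all add: curry_plus curry_M\<close>)

lemma M_zero:
  assumes "C \<in> obj X" "A \<in> obj X" "B \<in> obj X"
  shows "M C A (\<zero> (C \<otimes> A) B) = \<zero> (C \<otimes> A) B"
  by (rule M_eqI) (use assms in \<open>simp_all add: curry_zero\<close>)

lemma M_ev:
  assumes "C \<in> obj X" "B \<in> obj X"
  shows "M C \<lbrakk>C \<Rightarrow> B\<rbrakk> (\<epsilon> C B) = \<epsilon> C B"
  by (rule M_eqI) (use assms in simp_all)

lemma M_proj1:
  assumes "C \<in> obj X" "A \<in> obj X"
  shows "M C A (\<pi>\<^sub>1 C A) = \<pi>\<^sub>1 C A"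
  by (rule M_eqI) (use assms EL1_eta in \<open>simp_all add: eta_def\<close>)

text \<open>
  Both components are compared through the projections, which are linear.
\<close>

lemma M_pairing:
  assumes "C \<in> obj X" "A \<in> obj X" "f \<in> arr X" "g \<in> arr X" "src X f = C \<otimes> A" "src X g = C \<otimes> A"
  shows "M C A \<langle>f, g\<rangle> = \<langle>M C A f, M C A g\<rangle>"
proof (rule pairing_ext[of _ _ "tgt X f" "tgt X g"])
  show "M C A \<langle>f, g\<rangle> \<cdot> \<pi>\<^sub>0 (tgt X f) (tgt X g) = \<langle>M C A f, M C A g\<rangle> \<cdot> \<pi>\<^sub>0 (tgt X f) (tgt X g)"
    using assms by (subst M_compose_linear[symmetric]) simp_all
  show "M C A \<langle>f, g\<rangle> \<cdot> \<pi>\<^sub>1 (tgt X f) (tgt X g) = \<langle>M C A f, M C A g\<rangle> \<cdot> \<pi>\<^sub>1 (tgt X f) (tgt X g)"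
    using assms by (subst M_compose_linear[symmetric]) simp_all
qed (use assms in simp_all)

lemma M_idem:
  assumes "C \<in> obj X" "A \<in> obj X" "f \<in> arr X" "src X f = C \<otimes> A"
  shows "M C A (M C A f) = M C A f"
  by (rule M_eqI) (use assms in \<open>simp_all add: curry_M\<close>)

sublocale contextual: contextual_linearization X M
proof unfold_locales
  fix C A f assume "C \<in> obj X" "A \<in> obj X" "f \<in> arr X" "src X f = C \<otimes> A"
  then show "\<langle>\<pi>\<^sub>0 C A, \<zero> (C \<otimes> A) A\<rangle> \<cdot> M C A f = \<zero> (C \<otimes> A) (tgt X f)"
    by (simp add: M_at_zero)
qed (fact M_typing M_add M_zero M_chain M_base_change M_ev)+

lemma L_part1_eq:
  "\<lbrakk>A \<in> obj X; B \<in> obj X; f \<in> arr X; src X f = A \<otimes> B\<rbrakk> \<Longrightarrow> L_part1 X L A B f = M A B f"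
  by (simp add: L_part1_def M_eq uncurry_eq)

lemma L_part0_eq:
  "\<lbrakk>A \<in> obj X; B \<in> obj X; f \<in> arr X; src X f = A \<otimes> B\<rbrakk>
    \<Longrightarrow> L_part0 X L A B f = swap X A B \<cdot> M B A (swap X B A \<cdot> f)"
  by (simp add: L_part0_def M_eq uncurry_eq swap_def)

lemma uncurry_typing:
  assumes "C \<in> obj X" "B \<in> obj X" "g \<in> arr X" "src X g = A" "tgt X g = \<lbrakk>C \<Rightarrow> B\<rbrakk>"
  shows "uncurry X C B g \<in> arr X" "src X (uncurry X C B g) = C \<otimes> A" "tgt X (uncurry X C B g) = B"
    "\<Lambda> C A (uncurry X C B g) = g"
  using assms by (auto simp: uncurry_eq)

text \<open>
  Curry \<open>C\<close> away; what remains is [EL.3] for a map \<open>A \<times> B \<rightarrow> [C,D]\<close>.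
\<close>

lemma M_parts_commute:
  assumes "C \<in> obj X" "A \<in> obj X" "B \<in> obj X" "f \<in> arr X" "src X f = C \<otimes> (A \<otimes> B)"
  shows "sys_part1 X M C A B (sys_part0 X M C A B f) = sys_part0 X M C A B (sys_part1 X M C A B f)"
proof -
  let ?D = "tgt X f" and ?F = "\<Lambda> C (A \<otimes> B) f"
  have D: "?D \<in> obj X" using assms by simp
  have p1: "sys_part1 X M C A B g = uncurry X C ?D (L_part1 X L A B (\<Lambda> C (A \<otimes> B) g))"
    and p0: "sys_part0 X M C A B g = uncurry X C ?D (L_part0 X L A B (\<Lambda> C (A \<otimes> B) g))"
    if "g \<in> arr X" "src X g = C \<otimes> (A \<otimes> B)" "tgt X g = ?D" for g
    using that assms by (simp_all add: contextual.sys_part1_eq contextual.sys_part0_eq L_part1_eq L_part0_eq)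
  have parts_typing: "L_part1 X L A B G \<in> arr X" "src X (L_part1 X L A B G) = A \<otimes> B"
    "tgt X (L_part1 X L A B G) = \<lbrakk>C \<Rightarrow> ?D\<rbrakk>" "L_part0 X L A B G \<in> arr X"
    "src X (L_part0 X L A B G) = A \<otimes> B" "tgt X (L_part0 X L A B G) = \<lbrakk>C \<Rightarrow> ?D\<rbrakk>"
    if "G \<in> arr X" "src X G = A \<otimes> B" "tgt X G = \<lbrakk>C \<Rightarrow> ?D\<rbrakk>" for G
    using that assms by (simp_all add: L_part1_eq L_part0_eq swap_def)
  have F: "?F \<in> arr X" "src X ?F = A \<otimes> B" "tgt X ?F = \<lbrakk>C \<Rightarrow> ?D\<rbrakk>" using assms by simp_all
  have "L_part0 X L A B (L_part1 X L A B ?F) = L_part1 X L A B (L_part0 X L A B ?F)"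
    by (rule EL3[where C="\<lbrakk>C \<Rightarrow> ?D\<rbrakk>"]) (use assms in \<open>auto simp: hom_iff\<close>)
  then show ?thesis
    using assms F D parts_typing[OF F] by (simp add: p1 p0 uncurry_typing)
qed

text \<open>
  The curry of \<open>\<pi>\<^sub>1f : \<top> \<times> A \<rightarrow> B\<close> is \<open>f\<eta>\<close>, and \<open>\<eta>\<close> is linear by [EL.1]. So the trivial context
  changes nothing.
\<close>

lemma lin_of_sys_of_lin: "lin_of_sys X M = L"
proof
  fix f
  show "lin_of_sys X M f = L f"
  proof (cases "f \<in> arr X")
    case True
    have "M \<top> (src X f) (\<pi>\<^sub>1 \<top> (src X f) \<cdot> f) = \<pi>\<^sub>1 \<top> (src X f) \<cdot> L f"
    proof (rule M_eqI)
      have eta: "\<Lambda> \<top> (src X f) (\<pi>\<^sub>1 \<top> (src X f) \<cdot> g) = g \<cdot> eta X \<top> (tgt X g)"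
        if "g \<in> arr X" "src X g = src X f" for g
        by (rule ihom_ext[of \<top> "tgt X g" _ _ "src X f"]) (use True that in simp_all)
      have "L (f \<cdot> eta X \<top> (tgt X f)) = L f \<cdot> eta X \<top> (tgt X f)"
        by (rule L_compose_linear) (use True EL1_eta in simp_all)
      then show "L (\<Lambda> \<top> (src X f) (\<pi>\<^sub>1 \<top> (src X f) \<cdot> f)) = \<Lambda> \<top> (src X f) (\<pi>\<^sub>1 \<top> (src X f) \<cdot> L f)"
        using eta[of f] eta[of "L f"] True by simp
    qed (use True in simp_all)
    then show ?thesis using True by (simp add: lin_of_sys_def)
  qed (simp add: lin_of_sys_def L_undefined)
qed

lemma closed_sys_of_lin: "closed_linearizing_system X M"
proof unfold_locales
  fix C A f assume "\<not> (C \<in> obj X \<and> A \<in> obj X \<and> f \<in> arr X \<and> src X f = C \<otimes> A)"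
  then show "M C A f = undefined" unfolding sys_of_lin_def by (rule if_not_P)
next
  fix C A B f
  assume "C \<in> obj X" "A \<in> obj X" "f \<in> hom X (C \<otimes> A) B"
  then show "lin_of_sys X M (\<Lambda> C A f) = \<Lambda> C A (M C A f)"
    by (simp add: lin_of_sys_of_lin curry_M hom_iff)
next
  fix C A B f D
  assume "C \<in> obj X" "A \<in> obj X" "B \<in> obj X" "f \<in> hom X (C \<otimes> (A \<otimes> B)) D"
  then show "sys_part1 X M C A B (sys_part0 X M C A B f) = sys_part0 X M C A B (sys_part1 X M C A B f)"
    by (simp add: M_parts_commute hom_iff)
next
  fix C A B f g D
  assume "C \<in> obj X" "A \<in> obj X" "B \<in> obj X" "f \<in> hom X (C \<otimes> A) B" "g \<in> hom X (C \<otimes> B) D"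
  then show "M C A (\<langle>\<pi>\<^sub>0 C A, f\<rangle> \<cdot> g) = \<langle>\<pi>\<^sub>0 C A, M C A f\<rangle> \<cdot>
      M C B (\<langle>\<pi>\<^sub>0 C B, \<pi>\<^sub>1 C B \<oplus> \<langle>\<pi>\<^sub>0 C B, \<zero> (C \<otimes> B) A\<rangle> \<cdot> f\<rangle> \<cdot> g)"
    by (intro M_chain) (auto simp: hom_iff)
qed (auto simp: hom_iff M_add M_zero M_at_zero M_at_add M_base_change M_ev M_proj1
  M_compose_linear M_pairing M_idem prod_map_eq sum_map_def)

end

section \<open>From closed systems to closed differential combinators\<close>

context closed_linearizing_system
begin

lemma sys_typing [simp]:
  assumes "C \<in> obj X" "A \<in> obj X" "f \<in> arr X" "src X f = C \<otimes> A"
  shows "L C A f \<in> arr X" "src X (L C A f) = C \<otimes> A" "tgt X (L C A f) = tgt X f"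
  using sys_hom[of C A f "tgt X f"] assms by (auto simp: hom_iff)

lemma sys_rules [simp]:
  "\<lbrakk>C \<in> obj X; A \<in> obj X; f \<in> arr X; g \<in> arr X; src X f = C \<otimes> A; src X g = C \<otimes> A;
    tgt X f = tgt X g\<rbrakk> \<Longrightarrow> L C A (f \<oplus> g) = L C A f \<oplus> L C A g"
  "\<lbrakk>C \<in> obj X; A \<in> obj X; B \<in> obj X\<rbrakk> \<Longrightarrow> L C A (\<zero> (C \<otimes> A) B) = \<zero> (C \<otimes> A) B"
  "\<lbrakk>C \<in> obj X; A \<in> obj X\<rbrakk> \<Longrightarrow> L C A (\<pi>\<^sub>1 C A) = \<pi>\<^sub>1 C A"
  "\<lbrakk>C \<in> obj X; A \<in> obj X; B \<in> obj X\<rbrakk>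
    \<Longrightarrow> L C (A \<otimes> B) (\<pi>\<^sub>1 C (A \<otimes> B) \<cdot> \<pi>\<^sub>0 A B) = \<pi>\<^sub>1 C (A \<otimes> B) \<cdot> \<pi>\<^sub>0 A B"
  "\<lbrakk>C \<in> obj X; A \<in> obj X; B \<in> obj X\<rbrakk>
    \<Longrightarrow> L C (A \<otimes> B) (\<pi>\<^sub>1 C (A \<otimes> B) \<cdot> \<pi>\<^sub>1 A B) = \<pi>\<^sub>1 C (A \<otimes> B) \<cdot> \<pi>\<^sub>1 A B"
  "\<lbrakk>C \<in> obj X; A \<in> obj X; f \<in> arr X; g \<in> arr X; src X f = C \<otimes> A; src X g = C \<otimes> A\<rbrakk>
    \<Longrightarrow> L C A \<langle>f, g\<rangle> = \<langle>L C A f, L C A g\<rangle>"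
  "\<lbrakk>C \<in> obj X; A \<in> obj X; f \<in> arr X; src X f = C \<otimes> A\<rbrakk> \<Longrightarrow> L C A (L C A f) = L C A f"
  using sys_L1_add[of C A f "tgt X f" g] sys_L1_zero sys_L3 sys_L3_proj0 sys_L3_proj1
    sys_L4[of C A f "tgt X f" g "tgt X g"] sys_L6[of C A f "tgt X f"]
  by (auto simp: hom_iff)

text \<open>
  By [L.\<lambda>] the curry of \<open>L\<^sup>C[\<epsilon>]\<close> is \<open>L[\<lambda>(\<epsilon>)] = L[1] = 1\<close>, which is the curry of \<open>\<epsilon>\<close>.
\<close>

lemma L_ev:
  assumes "C \<in> obj X" "B \<in> obj X"
  shows "L C \<lbrakk>C \<Rightarrow> B\<rbrakk> (\<epsilon> C B) = \<epsilon> C B"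
proof -
  let ?E = "\<lbrakk>C \<Rightarrow> B\<rbrakk>"
  have "\<epsilon> C B \<in> hom X (C \<otimes> ?E) B" using assms by (simp add: hom_iff)
  from L_lambda[OF assms(1) ihom_obj[OF assms] this]
  have one: "\<one> ?E = \<Lambda> C ?E (L C ?E (\<epsilon> C B))" using assms by (simp add: lin_of_sys_def)
  have "\<epsilon> C B = \<langle>\<pi>\<^sub>0 C ?E, \<pi>\<^sub>1 C ?E \<cdot> \<one> ?E\<rangle> \<cdot> \<epsilon> C B" using assms by simp
  also have "\<dots> = L C ?E (\<epsilon> C B)" unfolding one using assms by (simp del: curry_of_ev)
  finally show ?thesis by simp
qed

sublocale contextual: contextual_linearization X L
proof unfold_locales
  fix C A f assume "C \<in> obj X" "A \<in> obj X" "f \<in> arr X" "src X f = C \<otimes> A"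
  then show "\<langle>\<pi>\<^sub>0 C A, \<zero> (C \<otimes> A) A\<rangle> \<cdot> L C A f = \<zero> (C \<otimes> A) (tgt X f)"
    using sys_L2_zero[of C A f "tgt X f"] by (simp add: hom_iff)
next
  fix C A B f g
  assume "C \<in> obj X" "A \<in> obj X" "B \<in> obj X" "f \<in> arr X" "g \<in> arr X" "src X f = C \<otimes> A"
    "tgt X f = B" "src X g = C \<otimes> B"
  then show "L C A (\<langle>\<pi>\<^sub>0 C A, f\<rangle> \<cdot> g) = \<langle>\<pi>\<^sub>0 C A, L C A f\<rangle> \<cdot>
      L C B (\<langle>\<pi>\<^sub>0 C B, \<pi>\<^sub>1 C B \<oplus> \<langle>\<pi>\<^sub>0 C B, \<zero> (C \<otimes> B) A\<rangle> \<cdot> f\<rangle> \<cdot> g)"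
    by (intro sys_L5[where D="tgt X g"]) (auto simp: hom_iff)
next
  fix C A h f C'
  assume *: "C \<in> obj X" "A \<in> obj X" "h \<in> arr X" "f \<in> arr X" "src X h = C'" "tgt X h = C"
    "src X f = C \<otimes> A"
  then have "prod_map X h (\<one> A) \<cdot> L C A f = L C' A (prod_map X h (\<one> A) \<cdot> f)"
    by (intro sys_L8[where B="tgt X f"]) (auto simp: hom_iff)
  then show "\<langle>\<pi>\<^sub>0 C' A \<cdot> h, \<pi>\<^sub>1 C' A\<rangle> \<cdot> L C A f = L C' A (\<langle>\<pi>\<^sub>0 C' A \<cdot> h, \<pi>\<^sub>1 C' A\<rangle> \<cdot> f)"
    using * by (auto simp: prod_map_eq)
qed (fact sys_typing sys_rules L_ev)+

text \<open>
  Linearization commutes with substituting a linear map \<open>k\<close> for the second argument: by [L.5], since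
  \<open>0k = 0\<close> makes the shift disappear.
\<close>

lemma L_at_linear:
  assumes "C \<in> obj X" "A \<in> obj X" "k \<in> arr X" "src X k = A'" "tgt X k = A" "g \<in> arr X" "src X g = C \<otimes> A"
    "L C A' (\<pi>\<^sub>1 C A' \<cdot> k) = \<pi>\<^sub>1 C A' \<cdot> k" "\<zero> (C \<otimes> A) A' \<cdot> k = \<zero> (C \<otimes> A) A"
    "x \<in> arr X" "a \<in> arr X" "src X x = src X a" "tgt X x = C" "tgt X a = A'"
  shows "\<langle>x, a \<cdot> k\<rangle> \<cdot> L C A g = \<langle>x, a\<rangle> \<cdot> L C A' (\<langle>\<pi>\<^sub>0 C A', \<pi>\<^sub>1 C A' \<cdot> k\<rangle> \<cdot> g)"
proof -
  have A': "A' \<in> obj X" using assms by auto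
  have "L C A' (\<langle>\<pi>\<^sub>0 C A', \<pi>\<^sub>1 C A' \<cdot> k\<rangle> \<cdot> g) = \<langle>\<pi>\<^sub>0 C A', L C A' (\<pi>\<^sub>1 C A' \<cdot> k)\<rangle> \<cdot>
      L C A (\<langle>\<pi>\<^sub>0 C A, \<pi>\<^sub>1 C A \<oplus> \<langle>\<pi>\<^sub>0 C A, \<zero> (C \<otimes> A) A'\<rangle> \<cdot> (\<pi>\<^sub>1 C A' \<cdot> k)\<rangle> \<cdot> g)"
    by (rule contextual.M_chain) (use assms A' in simp_all)
  also have "\<langle>\<pi>\<^sub>0 C A, \<pi>\<^sub>1 C A \<oplus> \<langle>\<pi>\<^sub>0 C A, \<zero> (C \<otimes> A) A'\<rangle> \<cdot> (\<pi>\<^sub>1 C A' \<cdot> k)\<rangle> \<cdot> g = g"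
    using assms A' by simp
  finally show ?thesis using assms A' by simp
qed

text \<open>
  The case of the two injections \<open>\<langle>1,0\<rangle>\<close> and \<open>\<langle>0,1\<rangle>\<close>: linearizing in a pair and then setting one
  component to zero is linearizing in the other component, with the first one fixed at zero.
\<close>

lemma L_at_inj:
  assumes "C \<in> obj X" "A \<in> obj X" "B \<in> obj X" "g \<in> arr X" "src X g = C \<otimes> (A \<otimes> B)"
    "x \<in> arr X" "v \<in> arr X" "src X x = Z" "src X v = Z" "tgt X x = C"
  shows "tgt X v = A \<Longrightarrow> \<langle>x, \<langle>v, \<zero> Z B\<rangle>\<rangle> \<cdot> L C (A \<otimes> B) g =
      \<langle>x, v\<rangle> \<cdot> L C A (\<langle>\<pi>\<^sub>0 C A, \<langle>\<pi>\<^sub>1 C A, \<zero> (C \<otimes> A) B\<rangle>\<rangle> \<cdot> g)"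
    "tgt X v = B \<Longrightarrow> \<langle>x, \<langle>\<zero> Z A, v\<rangle>\<rangle> \<cdot> L C (A \<otimes> B) g =
      \<langle>x, v\<rangle> \<cdot> L C B (\<langle>\<pi>\<^sub>0 C B, \<langle>\<zero> (C \<otimes> B) A, \<pi>\<^sub>1 C B\<rangle>\<rangle> \<cdot> g)"
  using L_at_linear[of C "A \<otimes> B" "\<langle>\<one> A, \<zero> A B\<rangle>" A g x v]
    L_at_linear[of C "A \<otimes> B" "\<langle>\<zero> B A, \<one> B\<rangle>" B g x v] assms by auto

abbreviation D :: "'m \<Rightarrow> 'm" where
  "D \<equiv> diff_of_sys X L"

lemma D_eq: "\<lbrakk>f \<in> arr X; src X f = A\<rbrakk> \<Longrightarrow> D f = L A A (sum_map X A \<cdot> f)"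
  by (simp add: diff_of_sys_def)

lemma D_typing [simp]:
  assumes "f \<in> arr X"
  shows "D f \<in> arr X" "src X (D f) = src X f \<otimes> src X f" "tgt X (D f) = tgt X f"
  using assms by (simp_all add: D_eq)

text \<open>
  The map \<open>f(h(c) + a)\<close> is \<open>f(x + a)\<close> with the context reindexed along \<open>x = h(c)\<close>, so [L.8] turns its
  linearization in \<open>a\<close> into the derivative of \<open>f\<close> at \<open>h(c)\<close>.
\<close>

lemma L_shift:
  assumes "C \<in> obj X" "h \<in> arr X" "src X h = C" "tgt X h = A" "f \<in> arr X" "src X f = A"
  shows "L C A ((\<pi>\<^sub>0 C A \<cdot> h \<oplus> \<pi>\<^sub>1 C A) \<cdot> f) = \<langle>\<pi>\<^sub>0 C A \<cdot> h, \<pi>\<^sub>1 C A\<rangle> \<cdot> D f"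
proof -
  have A: "A \<in> obj X" using assms by auto
  show ?thesis
    using assms A contextual.M_base_change[of A A h "sum_map X A \<cdot> f" C] by (simp add: D_eq)
qed

lemma D_at_add:
  assumes "f \<in> arr X" "src X f = A" "x \<in> arr X" "u \<in> arr X" "v \<in> arr X" "src X x = src X v" "src X u = src X v"
    "tgt X x = A" "tgt X u = A" "tgt X v = A"
  shows "\<langle>x, u \<oplus> v\<rangle> \<cdot> D f = \<langle>x, u\<rangle> \<cdot> D f \<oplus> \<langle>x, v\<rangle> \<cdot> D f"
proof -
  have A: "A \<in> obj X" using assms by auto
  have "\<langle>x, \<langle>u, v\<rangle>\<rangle> \<cdot> (prod_map X (\<one> A) (sum_map X A) \<cdot> D f) =
      \<langle>x, \<langle>u, v\<rangle>\<rangle> \<cdot> (prod_map X (\<one> A) (\<pi>\<^sub>0 A A) \<cdot> D f \<oplus> prod_map X (\<one> A) (\<pi>\<^sub>1 A A) \<cdot> D f)"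
    using sys_L2_add[of A A "sum_map X A \<cdot> f" "tgt X f"] assms A by (simp add: hom_iff D_eq)
  then show ?thesis using assms A by (simp add: prod_map_eq)
qed

lemma D_at_zero:
  assumes "f \<in> arr X" "src X f = A" "x \<in> arr X" "src X x = Z" "tgt X x = A"
  shows "\<langle>x, \<zero> Z A\<rangle> \<cdot> D f = \<zero> Z (tgt X f)"
proof -
  have A: "A \<in> obj X" and Z: "Z \<in> obj X" using assms by auto
  have "\<langle>x, \<zero> Z A\<rangle> \<cdot> (\<langle>\<pi>\<^sub>0 A A, \<zero> (A \<otimes> A) A\<rangle> \<cdot> D f) = \<langle>x, \<zero> Z A\<rangle> \<cdot> \<zero> (A \<otimes> A) (tgt X f)"
    using sys_L2_zero[of A A "sum_map X A \<cdot> f" "tgt X f"] assms A by (simp add: hom_iff D_eq)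
  then show ?thesis using assms A Z by simp
qed

lemma L_proj0: "\<lbrakk>C \<in> obj X; A \<in> obj X\<rbrakk> \<Longrightarrow> L C A (\<pi>\<^sub>0 C A) = \<zero> (C \<otimes> A) C"
  using contextual.M_const[of C A "\<one> C"] by simp

lemma D_ident: "A \<in> obj X \<Longrightarrow> D (\<one> A) = \<pi>\<^sub>1 A A"
  by (simp add: D_eq sum_map_def L_proj0)

lemma D_projections:
  assumes "A \<in> obj X" "B \<in> obj X"
  shows "D (\<pi>\<^sub>0 A B) = \<pi>\<^sub>1 (A \<otimes> B) (A \<otimes> B) \<cdot> \<pi>\<^sub>0 A B" "D (\<pi>\<^sub>1 A B) = \<pi>\<^sub>1 (A \<otimes> B) (A \<otimes> B) \<cdot> \<pi>\<^sub>1 A B"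
  using assms contextual.M_const[of "A \<otimes> B" "A \<otimes> B" "\<pi>\<^sub>0 A B"]
    contextual.M_const[of "A \<otimes> B" "A \<otimes> B" "\<pi>\<^sub>1 A B"]
  by (simp_all add: D_eq sum_map_def)

lemma D_add_zero_pairing:
  "\<lbrakk>f \<in> arr X; g \<in> arr X; src X f = src X g; tgt X f = tgt X g\<rbrakk> \<Longrightarrow> D (f \<oplus> g) = D f \<oplus> D g"
  "\<lbrakk>A \<in> obj X; B \<in> obj X\<rbrakk> \<Longrightarrow> D (\<zero> A B) = \<zero> (A \<otimes> A) B"
  "\<lbrakk>f \<in> arr X; g \<in> arr X; src X f = src X g\<rbrakk> \<Longrightarrow> D \<langle>f, g\<rangle> = \<langle>D f, D g\<rangle>"
  by (simp_all add: D_eq)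

text \<open>
  Apply [L.5] to \<open>f(x + v)\<close> followed by \<open>g\<close>; the shift by \<open>f(x + 0)\<close> moves \<open>g\<close> to the base point
  \<open>f(x)\<close>.
\<close>

lemma D_compose:
  assumes "f \<in> arr X" "g \<in> arr X" "tgt X f = src X g" "src X f = A"
  shows "D (f \<cdot> g) = \<langle>\<pi>\<^sub>0 A A \<cdot> f, D f\<rangle> \<cdot> D g"
proof -
  let ?B = "src X g"
  have A: "A \<in> obj X" and B: "?B \<in> obj X" using assms by auto
  have "D (f \<cdot> g) = L A A (\<langle>\<pi>\<^sub>0 A A, sum_map X A \<cdot> f\<rangle> \<cdot> (\<pi>\<^sub>1 A ?B \<cdot> g))"
    using assms A B by (simp add: D_eq)
  also have "\<dots> = \<langle>\<pi>\<^sub>0 A A, L A A (sum_map X A \<cdot> f)\<rangle> \<cdot>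
      L A ?B (\<langle>\<pi>\<^sub>0 A ?B, \<pi>\<^sub>1 A ?B \<oplus> \<langle>\<pi>\<^sub>0 A ?B, \<zero> (A \<otimes> ?B) A\<rangle> \<cdot> (sum_map X A \<cdot> f)\<rangle> \<cdot> (\<pi>\<^sub>1 A ?B \<cdot> g))"
    by (rule contextual.M_chain) (use assms A B in simp_all)
  also have "\<langle>\<pi>\<^sub>0 A ?B, \<pi>\<^sub>1 A ?B \<oplus> \<langle>\<pi>\<^sub>0 A ?B, \<zero> (A \<otimes> ?B) A\<rangle> \<cdot> (sum_map X A \<cdot> f)\<rangle> \<cdot> (\<pi>\<^sub>1 A ?B \<cdot> g) =
      (\<pi>\<^sub>0 A ?B \<cdot> f \<oplus> \<pi>\<^sub>1 A ?B) \<cdot> g"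
    using assms A B by (simp add: add_swap[of "\<pi>\<^sub>1 A ?B"])
  also have "L A ?B \<dots> = \<langle>\<pi>\<^sub>0 A ?B \<cdot> f, \<pi>\<^sub>1 A ?B\<rangle> \<cdot> D g"
    by (rule L_shift) (use assms A B in simp_all)
  finally show ?thesis using assms A B by (simp add: D_eq[of f A])
qed

text \<open>
  With \<open>y = 0\<close> the outer derivative linearizes \<open>D[f](x, u + v) = D[f](x,u) + D[f](x,v)\<close> in \<open>v\<close>. The
  first summand is constant, and the second is already linear.
\<close>

lemma DD_at_inner_increment:
  assumes "f \<in> arr X" "src X f = A" "x \<in> arr X" "u \<in> arr X" "v \<in> arr X" "src X x = Z" "src X u = Z" "src X v = Z"
    "tgt X x = A" "tgt X u = A" "tgt X v = A"
  shows "\<langle>\<langle>x, u\<rangle>, \<langle>\<zero> Z A, v\<rangle>\<rangle> \<cdot> D (D f) = \<langle>x, v\<rangle> \<cdot> D f"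
proof -
  let ?P = "A \<otimes> A"
  have A: "A \<in> obj X" and Z: "Z \<in> obj X" using assms by auto
  let ?base = "\<langle>\<pi>\<^sub>0 ?P A \<cdot> \<pi>\<^sub>0 A A, \<pi>\<^sub>1 ?P A\<rangle>"
  have split: "\<langle>\<pi>\<^sub>0 ?P A, \<langle>\<zero> (?P \<otimes> A) A, \<pi>\<^sub>1 ?P A\<rangle>\<rangle> \<cdot> (sum_map X ?P \<cdot> D f) = \<pi>\<^sub>0 ?P A \<cdot> D f \<oplus> ?base \<cdot> D f"
  proof -
    have "\<pi>\<^sub>0 ?P A \<oplus> \<langle>\<zero> (?P \<otimes> A) A, \<pi>\<^sub>1 ?P A\<rangle> =
        \<langle>\<pi>\<^sub>0 ?P A \<cdot> \<pi>\<^sub>0 A A, \<pi>\<^sub>0 ?P A \<cdot> \<pi>\<^sub>1 A A \<oplus> \<pi>\<^sub>1 ?P A\<rangle>"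
      by (rule pairing_ext[of _ _ A A]) (use A in simp_all)
    then show ?thesis using assms A by (simp add: D_at_add[where A=A])
  qed
  have "\<langle>\<langle>x, u\<rangle>, \<langle>\<zero> Z A, v\<rangle>\<rangle> \<cdot> D (D f) =
      \<langle>\<langle>x, u\<rangle>, v\<rangle> \<cdot> L ?P A (\<langle>\<pi>\<^sub>0 ?P A, \<langle>\<zero> (?P \<otimes> A) A, \<pi>\<^sub>1 ?P A\<rangle>\<rangle> \<cdot> (sum_map X ?P \<cdot> D f))"
    using assms A Z L_at_inj(2)[of ?P A A "sum_map X ?P \<cdot> D f" "\<langle>x, u\<rangle>" v Z] by (simp add: D_eq[of "D f" ?P])
  also have "\<dots> = \<langle>\<langle>x, u\<rangle>, v\<rangle> \<cdot> (L ?P A (\<pi>\<^sub>0 ?P A \<cdot> D f) \<oplus> L ?P A (?base \<cdot> D f))"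
    unfolding split using assms A by (subst sys_rules(1)) simp_all
  also have "L ?P A (\<pi>\<^sub>0 ?P A \<cdot> D f) = \<zero> (?P \<otimes> A) (tgt X f)"
    using contextual.M_const[of ?P A "D f"] assms A by simp
  also have "L ?P A (?base \<cdot> D f) = ?base \<cdot> D f"
    using contextual.M_base_change[of A A "\<pi>\<^sub>0 A A" "D f" ?P] assms A by (simp add: D_eq[of f A])
  finally show ?thesis using assms A Z by simp
qed

text \<open>
  The mixed term: linearize \<open>D[f](x + y, u)\<close> in \<open>y\<close>.
\<close>

lemma DD_at_outer_increment:
  assumes "f \<in> arr X" "src X f = A" "x \<in> arr X" "u \<in> arr X" "y \<in> arr X" "src X x = Z" "src X u = Z" "src X y = Z"
    "tgt X x = A" "tgt X u = A" "tgt X y = A"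
  shows "\<langle>\<langle>x, u\<rangle>, \<langle>y, \<zero> Z A\<rangle>\<rangle> \<cdot> D (D f) = \<langle>\<langle>x, u\<rangle>, y\<rangle> \<cdot>
    L (A \<otimes> A) A (\<langle>\<pi>\<^sub>0 (A \<otimes> A) A \<cdot> \<pi>\<^sub>0 A A \<oplus> \<pi>\<^sub>1 (A \<otimes> A) A, \<pi>\<^sub>0 (A \<otimes> A) A \<cdot> \<pi>\<^sub>1 A A\<rangle> \<cdot> D f)"
proof -
  let ?P = "A \<otimes> A"
  have A: "A \<in> obj X" and Z: "Z \<in> obj X" using assms by auto
  have "\<pi>\<^sub>0 ?P A \<oplus> \<langle>\<pi>\<^sub>1 ?P A, \<zero> (?P \<otimes> A) A\<rangle> =
        \<langle>\<pi>\<^sub>0 ?P A \<cdot> \<pi>\<^sub>0 A A \<oplus> \<pi>\<^sub>1 ?P A, \<pi>\<^sub>0 ?P A \<cdot> \<pi>\<^sub>1 A A\<rangle>"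
      by (rule pairing_ext[of _ _ A A]) (use A in simp_all)
  then show ?thesis
    using assms A Z L_at_inj(1)[of ?P A A "sum_map X ?P \<cdot> D f" "\<langle>x, u\<rangle>" y Z] by (simp add: D_eq[of "D f" ?P])
qed

text \<open>
  The mixed term is the double linearization of \<open>g(x,(y,u)) = f(x + y + u)\<close>, in \<open>u\<close> and then in \<open>y\<close>.
  As \<open>g\<close> is symmetric in \<open>y\<close> and \<open>u\<close>, exchanging them exchanges the order, which is immaterial by [L.7].
\<close>

lemma DD_outer_increments_commute:
  assumes "f \<in> arr X" "src X f = A" "x \<in> arr X" "u \<in> arr X" "y \<in> arr X" "src X x = Z" "src X u = Z" "src X y = Z"
    "tgt X x = A" "tgt X u = A" "tgt X y = A"
  shows "\<langle>\<langle>x, u\<rangle>, \<langle>y, \<zero> Z A\<rangle>\<rangle> \<cdot> D (D f) = \<langle>\<langle>x, y\<rangle>, \<langle>u, \<zero> Z A\<rangle>\<rangle> \<cdot> D (D f)"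
proof -
  let ?P = "A \<otimes> A"
  let ?k = "\<langle>\<pi>\<^sub>0 ?P A \<cdot> \<pi>\<^sub>0 A A \<oplus> \<pi>\<^sub>1 ?P A, \<pi>\<^sub>0 ?P A \<cdot> \<pi>\<^sub>1 A A\<rangle> \<cdot> D f"
  let ?g = "(\<pi>\<^sub>0 A ?P \<oplus> (\<pi>\<^sub>1 A ?P \<cdot> \<pi>\<^sub>0 A A \<oplus> \<pi>\<^sub>1 A ?P \<cdot> \<pi>\<^sub>1 A A)) \<cdot> f"
  have A: "A \<in> obj X" and Z: "Z \<in> obj X" using assms by auto
  have shift: "L ?P A ((\<pi>\<^sub>0 ?P A \<cdot> \<pi>\<^sub>0 A A \<oplus> (\<pi>\<^sub>0 ?P A \<cdot> \<pi>\<^sub>1 A A \<oplus> \<pi>\<^sub>1 ?P A)) \<cdot> f) =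
      \<langle>\<pi>\<^sub>0 ?P A \<cdot> \<pi>\<^sub>0 A A \<oplus> \<pi>\<^sub>0 ?P A \<cdot> \<pi>\<^sub>1 A A, \<pi>\<^sub>1 ?P A\<rangle> \<cdot> D f"
    using L_shift[of ?P "sum_map X A" A f] assms A by (simp add: sum_map_def add_right_assoc)
  have part1: "sys_part1 X L A A A ?g =
      \<langle>\<pi>\<^sub>0 A ?P \<oplus> \<pi>\<^sub>1 A ?P \<cdot> \<pi>\<^sub>0 A A, \<pi>\<^sub>1 A ?P \<cdot> \<pi>\<^sub>1 A A\<rangle> \<cdot> D f"
    using assms A by (simp add: sys_part1_def assoc1_def assoc1_inv_def prod_map_eq shift)
  have part0: "sys_part0 X L A A A ?g =
      \<langle>\<pi>\<^sub>0 A ?P \<oplus> \<pi>\<^sub>1 A ?P \<cdot> \<pi>\<^sub>1 A A, \<pi>\<^sub>1 A ?P \<cdot> \<pi>\<^sub>0 A A\<rangle> \<cdot> D f"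
    using assms A
    by (simp add: sys_part0_def assoc0_def assoc0_inv_def prod_map_eq shift
        add_swap[of "\<pi>\<^sub>1 ?P A" "\<pi>\<^sub>0 ?P A \<cdot> \<pi>\<^sub>1 A A"])
  have "\<langle>\<langle>x, u\<rangle>, y\<rangle> \<cdot> L ?P A ?k = \<langle>x, \<langle>y, u\<rangle>\<rangle> \<cdot> sys_part0 X L A A A (sys_part1 X L A A A ?g)"
    unfolding part1 using assms A
    by (simp add: sys_part0_def assoc0_def assoc0_inv_def prod_map_eq)
  also have "\<dots> = \<langle>x, \<langle>y, u\<rangle>\<rangle> \<cdot> sys_part1 X L A A A (sys_part0 X L A A A ?g)"
    using sys_L7[of A A A ?g "tgt X f"] assms A by (simp add: hom_iff)
  also have "\<dots> = \<langle>\<langle>x, y\<rangle>, u\<rangle> \<cdot> L ?P A ?k"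
    unfolding part0 using assms A
    by (simp add: sys_part1_def assoc1_def assoc1_inv_def prod_map_eq)
  finally show ?thesis using assms by (simp add: DD_at_outer_increment)
qed

lemma DD_split:
  assumes "f \<in> arr X" "src X f = A" "x \<in> arr X" "u \<in> arr X" "y \<in> arr X" "v \<in> arr X"
    "src X x = Z" "src X u = Z" "src X y = Z" "src X v = Z"
    "tgt X x = A" "tgt X u = A" "tgt X y = A" "tgt X v = A"
  shows "\<langle>\<langle>x, u\<rangle>, \<langle>y, v\<rangle>\<rangle> \<cdot> D (D f) = \<langle>\<langle>x, u\<rangle>, \<langle>y, \<zero> Z A\<rangle>\<rangle> \<cdot> D (D f) \<oplus> \<langle>x, v\<rangle> \<cdot> D f"
proof -
  have A: "A \<in> obj X" and Z: "Z \<in> obj X" using assms by auto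
  have "\<langle>y, v\<rangle> = \<langle>y, \<zero> Z A\<rangle> \<oplus> \<langle>\<zero> Z A, v\<rangle>" using assms A Z by simp
  then have "\<langle>\<langle>x, u\<rangle>, \<langle>y, v\<rangle>\<rangle> \<cdot> D (D f) =
      \<langle>\<langle>x, u\<rangle>, \<langle>y, \<zero> Z A\<rangle>\<rangle> \<cdot> D (D f) \<oplus> \<langle>\<langle>x, u\<rangle>, \<langle>\<zero> Z A, v\<rangle>\<rangle> \<cdot> D (D f)"
    using D_at_add[of "D f" "A \<otimes> A" "\<langle>x, u\<rangle>" "\<langle>y, \<zero> Z A\<rangle>" "\<langle>\<zero> Z A, v\<rangle>"] assms A Z by simp
  then show ?thesis using DD_at_inner_increment[of f A x u v Z] assms by simp
qed

text \<open>
  The partial derivative of \<open>f\<close> in its second argument linearizes \<open>f(c, a + v)\<close> in \<open>v\<close> with context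
  \<open>(c,a)\<close>, while \<open>D[\<lambda>(f)]\<close> linearizes \<open>\<lambda>(f)(a + v)\<close> with context \<open>a\<close>; the two agree by
  \<open>M_of_ev_in_larger_context\<close>.
\<close>

lemma D_curry:
  assumes "C \<in> obj X" "A \<in> obj X" "f \<in> arr X" "src X f = C \<otimes> A"
  shows "D (\<Lambda> C A f) = \<Lambda> C (A \<otimes> A) (partial_derivative X D C A f)"
proof (rule curry_eqI[where B="tgt X f"])
  let ?P = "C \<otimes> A" and ?Q = "C \<otimes> (A \<otimes> A)" and ?V = "A \<otimes> A" and ?B = "tgt X f"
  let ?c = "\<pi>\<^sub>0 C ?V" and ?a = "\<pi>\<^sub>1 C ?V \<cdot> \<pi>\<^sub>0 A A" and ?v = "\<pi>\<^sub>1 C ?V \<cdot> \<pi>\<^sub>1 A A"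
  have B: "?B \<in> obj X" using assms by simp
  have "partial_derivative X D C A f = \<langle>\<langle>?c, ?a\<rangle>, \<langle>\<zero> ?Q C, ?v\<rangle>\<rangle> \<cdot> L ?P ?P (sum_map X ?P \<cdot> f)"
    using assms by (simp add: partial_derivative_def prod_map_eq D_eq)
  also have "\<dots> = \<langle>\<langle>?c, ?a\<rangle>, ?v\<rangle> \<cdot>
      L ?P A (\<langle>\<pi>\<^sub>0 ?P A, \<langle>\<zero> (?P \<otimes> A) C, \<pi>\<^sub>1 ?P A\<rangle>\<rangle> \<cdot> (sum_map X ?P \<cdot> f))"
    by (rule L_at_inj) (use assms in simp_all)
  also have "\<langle>\<pi>\<^sub>0 ?P A, \<langle>\<zero> (?P \<otimes> A) C, \<pi>\<^sub>1 ?P A\<rangle>\<rangle> \<cdot> (sum_map X ?P \<cdot> f) =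
      \<langle>\<pi>\<^sub>0 ?P A \<cdot> \<pi>\<^sub>0 C A, \<langle>\<pi>\<^sub>0 ?P A \<cdot> \<pi>\<^sub>1 C A, \<pi>\<^sub>1 ?P A\<rangle> \<cdot> (sum_map X A \<cdot> \<Lambda> C A f)\<rangle> \<cdot> \<epsilon> C ?B"
  proof -
    have "\<pi>\<^sub>0 ?P A \<oplus> \<langle>\<zero> (?P \<otimes> A) C, \<pi>\<^sub>1 ?P A\<rangle> = \<langle>\<pi>\<^sub>0 ?P A \<cdot> \<pi>\<^sub>0 C A, \<pi>\<^sub>0 ?P A \<cdot> \<pi>\<^sub>1 C A \<oplus> \<pi>\<^sub>1 ?P A\<rangle>"
      by (rule pairing_ext[of _ _ C A]) (use assms in simp_all)
    then show ?thesis using assms by simp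
  qed
  also have "L ?P A \<dots> =
      \<langle>\<pi>\<^sub>0 ?P A \<cdot> \<pi>\<^sub>0 C A, \<langle>\<pi>\<^sub>0 ?P A \<cdot> \<pi>\<^sub>1 C A, \<pi>\<^sub>1 ?P A\<rangle> \<cdot> L A A (sum_map X A \<cdot> \<Lambda> C A f)\<rangle> \<cdot> \<epsilon> C ?B"
    by (rule contextual.M_of_ev_in_larger_context) (use assms B in simp_all)
  finally show "\<langle>?c, \<pi>\<^sub>1 C ?V \<cdot> D (\<Lambda> C A f)\<rangle> \<cdot> \<epsilon> C ?B = partial_derivative X D C A f"
    using assms by (simp add: D_eq)
qed (use assms in simp_all)

lemma differential_combinator_diff_of_sys: "differential_combinator X D"
proof unfold_locales
  fix f assume "f \<notin> arr X"
  then show "D f = undefined" by (simp add: diff_of_sys_def)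
next
  fix f A B assume "f \<in> hom X A B"
  then show "prod_map X (\<one> A) (sum_map X A) \<cdot> D f =
      prod_map X (\<one> A) (\<pi>\<^sub>0 A A) \<cdot> D f \<oplus> prod_map X (\<one> A) (\<pi>\<^sub>1 A A) \<cdot> D f"
    using sys_L2_add[of A A "sum_map X A \<cdot> f" B] by (simp add: hom_iff D_eq)
next
  fix f A B assume "f \<in> hom X A B"
  then show "ell X A A A A \<cdot> D (D f) = D f"
    using DD_at_inner_increment[of f A "\<pi>\<^sub>0 A A" "\<zero> (A \<otimes> A) A" "\<pi>\<^sub>1 A A" "A \<otimes> A"]
    by (simp add: hom_iff ell_def prod_map_eq)
next
  fix f A B assume "f \<in> hom X A B"
  then have f: "f \<in> arr X" "src X f = A" "A \<in> obj X" by (auto simp: hom_iff)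
  let ?P = "A \<otimes> A"
  let ?x = "\<pi>\<^sub>0 ?P ?P \<cdot> \<pi>\<^sub>0 A A" and ?u = "\<pi>\<^sub>0 ?P ?P \<cdot> \<pi>\<^sub>1 A A"
    and ?y = "\<pi>\<^sub>1 ?P ?P \<cdot> \<pi>\<^sub>0 A A" and ?v = "\<pi>\<^sub>1 ?P ?P \<cdot> \<pi>\<^sub>1 A A"
  have "\<langle>\<langle>?x, ?y\<rangle>, \<langle>?u, ?v\<rangle>\<rangle> \<cdot> D (D f) = \<langle>\<langle>?x, ?u\<rangle>, \<langle>?y, ?v\<rangle>\<rangle> \<cdot> D (D f)"
    using DD_split[of f A ?x ?u ?y ?v "?P \<otimes> ?P"] DD_split[of f A ?x ?y ?u ?v "?P \<otimes> ?P"]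
      DD_outer_increments_commute[of f A ?x ?u ?y "?P \<otimes> ?P"] f by simp
  then show "interchange X A A A A \<cdot> D (D f) = D (D f)"
    using f by (simp add: interchange_def prod_map_eq)
qed (auto simp: hom_iff D_ident D_projections D_compose D_at_add D_at_zero D_add_zero_pairing
  prod_map_eq)

lemma CD_lambda_diff_of_sys: "CD_lambda X D"
  unfolding CD_lambda_def using D_curry by (auto simp: hom_iff)

text \<open>
  Both are linearizations of \<open>f\<close> at \<open>0\<close>: reindex the context of \<open>f(x + v)\<close> along \<open>0 : \<top> \<rightarrow> A\<close>.
\<close>

lemma lin_of_diff_of_sys: "lin_of_diff X D = lin_of_sys X L"
proof
  fix f
  show "lin_of_diff X D f = lin_of_sys X L f"
  proof (cases "f \<in> arr X")
    case True
    let ?A = "src X f"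
    \<comment> \<open>\<open>0 : A \<rightarrow> A\<close> factors through the terminal object.\<close>
    have "lin_of_diff X D f = \<langle>\<zero> ?A \<top> \<cdot> \<zero> \<top> ?A, \<one> ?A\<rangle> \<cdot> L ?A ?A (sum_map X ?A \<cdot> f)"
      using True by (simp add: lin_of_diff_def D_eq)
    also have "\<dots> = \<langle>\<zero> ?A \<top>, \<one> ?A\<rangle> \<cdot>
        L \<top> ?A (\<langle>\<pi>\<^sub>0 \<top> ?A \<cdot> \<zero> \<top> ?A, \<pi>\<^sub>1 \<top> ?A\<rangle> \<cdot> (sum_map X ?A \<cdot> f))"
      by (rule contextual.M_at_base_change) (use True in simp_all)
    also have "\<dots> = lin_of_sys X L f"
      using True by (simp add: lin_of_sys_def)
    finally show ?thesis .
  qed (simp add: lin_of_diff_def lin_of_sys_def)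
qed

lemma sys_of_lin_of_sys: "sys_of_lin X (lin_of_sys X L) = L"
proof (intro ext)
  fix C A f
  show "sys_of_lin X (lin_of_sys X L) C A f = L C A f"
  proof (cases "C \<in> obj X \<and> A \<in> obj X \<and> f \<in> arr X \<and> src X f = C \<otimes> A")
    case True
    then show ?thesis
      using L_lambda[of C A f "tgt X f"] by (simp add: sys_of_lin_def hom_iff uncurry_eq)
  next
    case False
    then show ?thesis using sys_undefined[OF False] unfolding sys_of_lin_def by (simp only: if_False)
  qed
qed

end

section \<open>The correspondence\<close>

context cartesian_closed_differential_category
begin

lemma sys_of_lin_of_diff: "sys_of_lin X (lin_of_diff X D) = sys_of_diff X D"
proof (intro ext)
  fix C A f
  show "sys_of_lin X (lin_of_diff X D) C A f = sys_of_diff X D C A f"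
  proof (cases "C \<in> obj X \<and> A \<in> obj X \<and> f \<in> arr X \<and> src X f = C \<otimes> A")
    case True
    then show ?thesis
      by (simp add: sys_of_lin_def sys_of_diff_def uncurry_eq lin_of_diff_curry ell_def prod_map_eq)
  next
    case False
    then show ?thesis unfolding sys_of_lin_def sys_of_diff_def by (simp only: if_False)
  qed
qed

lemma diff_of_sys_of_diff: "diff_of_sys X (sys_of_diff X D) = D"
proof
  fix f
  show "diff_of_sys X (sys_of_diff X D) f = D f"
  proof (cases "f \<in> arr X")
    case True
    then show ?thesis
      by (simp add: diff_of_sys_def sys_of_diff_def ell_def prod_map_eq sum_map_def)
  qed (simp add: diff_of_sys_def D_undefined)
qed

end

lemma (in exponentiable_linearizing_combinator) diff_of_sys_of_lin:
  "diff_of_sys X (sys_of_lin X L) = diff_of_lin X L"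
  by (rule ext) (simp add: diff_of_sys_def sys_of_lin_def diff_of_lin_def)

lemma mutually_inverseI:
  assumes "\<And>s. s \<in> S \<Longrightarrow> F s \<in> T" "\<And>t. t \<in> T \<Longrightarrow> G t \<in> S"
    "\<And>s. s \<in> S \<Longrightarrow> G (F s) = s" "\<And>t. t \<in> T \<Longrightarrow> F (G t) = t"
  shows "mutually_inverse F G S T"
  unfolding mutually_inverse_def using assms
  by (auto intro!: bij_betw_byWitness[where f'=G] bij_betw_byWitness[where f'=F])

text \<open>
  Bijections between fibres over the same base assemble into a bijection of total spaces; this turns
  the comparison for one category into a comparison of pairs of a category and a structure on it.
\<close>

lemma mutually_inverse_total:
  assumes "\<And>Y. P Y \<Longrightarrow> mutually_inverse (F Y) (G Y) (S Y) (T Y)"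
  shows "mutually_inverse (\<lambda>(Y, s). (Y, F Y s)) (\<lambda>(Y, t). (Y, G Y t))
    {(Y, s). P Y \<and> s \<in> S Y} {(Y, t). P Y \<and> t \<in> T Y}"
proof -
  have "F Y s \<in> T Y" "G Y (F Y s) = s" if "P Y" "s \<in> S Y" for Y s
    using assms[OF that(1)] that(2) unfolding mutually_inverse_def
    by (auto dest: bij_betwE)
  moreover have "G Y t \<in> S Y" "F Y (G Y t) = t" if "P Y" "t \<in> T Y" for Y t
    using assms[OF that(1)] that(2) unfolding mutually_inverse_def
    by (auto dest: bij_betwE)
  ultimately show ?thesis by (intro mutually_inverseI) auto
qed

lemma cartesian_closed_differential_category_iff:
  "cartesian_closed_differential_category X D \<longleftrightarrow>
    cartesian_closed_left_additive_category X \<and> differential_combinator X D \<and> CD_lambda X D"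
  by (auto simp: cartesian_closed_differential_category_def
      cartesian_closed_differential_category_axioms_def)

context cartesian_closed_left_additive_category
begin

lemma closed_diff_comparisons:
  assumes "differential_combinator X D" "CD_lambda X D"
  shows "exponentiable_linearizing_combinator X (lin_of_diff X D)"
    "closed_linearizing_system X (sys_of_diff X D)"
    "diff_of_sys X (sys_of_diff X D) = D"
    "lin_of_sys X (sys_of_diff X D) = lin_of_diff X D"
    "diff_of_lin X (lin_of_diff X D) = D"
proof -
  interpret cartesian_closed_differential_category X D
    by (simp add: cartesian_closed_differential_category_iff assms
        cartesian_closed_left_additive_category_axioms)
  interpret lin: exponentiable_linearizing_combinator X "lin_of_diff X D"
    by (rule exponentiable_lin_of_diff)
  show "exponentiable_linearizing_combinator X (lin_of_diff X D)"
    by (rule exponentiable_lin_of_diff)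
  show "closed_linearizing_system X (sys_of_diff X D)"
    using lin.closed_sys_of_lin by (simp add: sys_of_lin_of_diff)
  show "diff_of_sys X (sys_of_diff X D) = D" by (rule diff_of_sys_of_diff)
  show "lin_of_sys X (sys_of_diff X D) = lin_of_diff X D"
    using lin.lin_of_sys_of_lin by (simp add: sys_of_lin_of_diff)
  show "diff_of_lin X (lin_of_diff X D) = D"
    using lin.diff_of_sys_of_lin by (simp add: sys_of_lin_of_diff diff_of_sys_of_diff)
qed

lemma closed_sys_comparisons:
  assumes "closed_linearizing_system X L"
  shows "differential_combinator X (diff_of_sys X L)" "CD_lambda X (diff_of_sys X L)"
    "exponentiable_linearizing_combinator X (lin_of_sys X L)"
    "sys_of_lin X (lin_of_sys X L) = L" "sys_of_diff X (diff_of_sys X L) = L"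
proof -
  interpret closed_linearizing_system X L by fact
  show diff: "differential_combinator X (diff_of_sys X L)" "CD_lambda X (diff_of_sys X L)"
    by (rule differential_combinator_diff_of_sys CD_lambda_diff_of_sys)+
  interpret diff: cartesian_closed_differential_category X "diff_of_sys X L"
    by (simp add: cartesian_closed_differential_category_iff diff
        cartesian_closed_left_additive_category_axioms)
  show "exponentiable_linearizing_combinator X (lin_of_sys X L)"
    using diff.exponentiable_lin_of_diff by (simp add: lin_of_diff_of_sys)
  show "sys_of_lin X (lin_of_sys X L) = L" by (rule sys_of_lin_of_sys)
  show "sys_of_diff X (diff_of_sys X L) = L"
    using diff.sys_of_lin_of_diff by (simp add: lin_of_diff_of_sys sys_of_lin_of_sys)
qed

lemma exponentiable_lin_comparisons:
  assumes "exponentiable_linearizing_combinator X L"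
  shows "closed_linearizing_system X (sys_of_lin X L)" "lin_of_sys X (sys_of_lin X L) = L"
    "differential_combinator X (diff_of_lin X L)" "CD_lambda X (diff_of_lin X L)"
    "lin_of_diff X (diff_of_lin X L) = L"
proof -
  interpret exponentiable_linearizing_combinator X L by fact
  interpret sys: closed_linearizing_system X "sys_of_lin X L" by (rule closed_sys_of_lin)
  show "closed_linearizing_system X (sys_of_lin X L)" by (rule closed_sys_of_lin)
  show "lin_of_sys X (sys_of_lin X L) = L" by (rule lin_of_sys_of_lin)
  show "differential_combinator X (diff_of_lin X L)" "CD_lambda X (diff_of_lin X L)"
    using sys.differential_combinator_diff_of_sys sys.CD_lambda_diff_of_sys by (simp_all add: diff_of_sys_of_lin)
  show "lin_of_diff X (diff_of_lin X L) = L"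
    using sys.lin_of_diff_of_sys by (simp add: diff_of_sys_of_lin lin_of_sys_of_lin)
qed

lemma mutually_inverse_diff_sys:
  "mutually_inverse (sys_of_diff X) (diff_of_sys X)
    {D. differential_combinator X D \<and> CD_lambda X D} {L. closed_linearizing_system X L}"
  by (rule mutually_inverseI) (auto simp: closed_diff_comparisons closed_sys_comparisons)

lemma mutually_inverse_sys_lin:
  "mutually_inverse (lin_of_sys X) (sys_of_lin X)
    {L. closed_linearizing_system X L} {L. exponentiable_linearizing_combinator X L}"
  by (rule mutually_inverseI) (auto simp: closed_sys_comparisons exponentiable_lin_comparisons)

lemma mutually_inverse_diff_lin:
  "mutually_inverse (lin_of_diff X) (diff_of_lin X)
    {D. differential_combinator X D \<and> CD_lambda X D}
    {L. exponentiable_linearizing_combinator X L}"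
  by (rule mutually_inverseI) (auto simp: closed_diff_comparisons exponentiable_lin_comparisons)

end

theorem theorem6p12:
  fixes X :: "('o, 'm) cartesian_closed_left_additive_category"
  assumes "cartesian_closed_left_additive_category X"
  shows
    "(\<forall>D. differential_combinator X D \<longrightarrow> (CD_lambda X D \<longleftrightarrow> CD_ev X D))
     \<and> mutually_inverse (sys_of_diff X) (diff_of_sys X)
         {D. differential_combinator X D \<and> CD_lambda X D} {L. closed_linearizing_system X L}
     \<and> mutually_inverse (lin_of_sys X) (sys_of_lin X)
         {L. closed_linearizing_system X L} {L. exponentiable_linearizing_combinator X L}
     \<and> mutually_inverse (lin_of_diff X) (diff_of_lin X)
         {D. differential_combinator X D \<and> CD_lambda X D}
         {L. exponentiable_linearizing_combinator X L}
     \<and> (\<forall>D. differential_combinator X D \<and> CD_lambda X D \<longrightarrow>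
           lin_of_sys X (sys_of_diff X D) = lin_of_diff X D)
     \<and> mutually_inverse (\<lambda>(Y, D). (Y, lin_of_diff Y D)) (\<lambda>(Y, L). (Y, diff_of_lin Y L))
         {(Y :: ('o, 'm) cartesian_closed_left_additive_category, D).
            cartesian_closed_differential_category Y D}
         {(Y, L). cartesian_closed_left_additive_category Y \<and>
            exponentiable_linearizing_combinator Y L}
     \<and> mutually_inverse (\<lambda>(Y, D). (Y, sys_of_diff Y D)) (\<lambda>(Y, L). (Y, diff_of_sys Y L))
         {(Y :: ('o, 'm) cartesian_closed_left_additive_category, D).
            cartesian_closed_differential_category Y D}
         {(Y, L). cartesian_closed_left_additive_category Y \<and> closed_linearizing_system Y L}"
proof -
  interpret cartesian_closed_left_additive_category X by fact
  show ?thesis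
    unfolding cartesian_closed_differential_category_iff
    using CD_lambda_iff_CD_ev mutually_inverse_diff_sys mutually_inverse_sys_lin
      mutually_inverse_diff_lin
  proof (intro conjI allI impI; (elim conjE)?)
    show "lin_of_sys X (sys_of_diff X D) = lin_of_diff X D"
      if "differential_combinator X D" "CD_lambda X D" for D
      using that by (rule closed_diff_comparisons)
    show "mutually_inverse (\<lambda>(Y, D). (Y, lin_of_diff Y D)) (\<lambda>(Y, L). (Y, diff_of_lin Y L))
        {(Y :: ('o, 'm) cartesian_closed_left_additive_category, D).
           cartesian_closed_left_additive_category Y \<and> differential_combinator Y D \<and> CD_lambda Y D}
        {(Y, L). cartesian_closed_left_additive_category Y \<and>
           exponentiable_linearizing_combinator Y L}"
      using mutually_inverse_total[OF
          cartesian_closed_left_additive_category.mutually_inverse_diff_lin]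
      by simp
    show "mutually_inverse (\<lambda>(Y, D). (Y, sys_of_diff Y D)) (\<lambda>(Y, L). (Y, diff_of_sys Y L))
        {(Y :: ('o, 'm) cartesian_closed_left_additive_category, D).
           cartesian_closed_left_additive_category Y \<and> differential_combinator Y D \<and> CD_lambda Y D}
        {(Y, L). cartesian_closed_left_additive_category Y \<and> closed_linearizing_system Y L}"
      using mutually_inverse_total[OF
          cartesian_closed_left_additive_category.mutually_inverse_diff_sys]
      by simp
  qed blast+
qed

end
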